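(* There is an $\epsilon > 0$ such that for all sufficiently large finite sets $A \subset \mathbb{R}$ with $|AA| \leq |A|^{1+\epsilon}$ there is no decomposition $A = B + C$ with $B, C \subset \mathbb{R}$ and $|B|, |C| \geq 2$.
   Context: For finite sets $X,Y \subset \mathbb{R}$, $X+Y=\{x+y : x\in X, y\in Y\}$ and $XY = \{xy : x \in X, y \in Y\}$. *)

theory Defs
  imports Complex_Main "HOL-Library.Set_Algebras"
begin

text \<open>
  The sum set and product set of sets of reals are the operations \<open>+\<close> and \<open>*\<close> on
  \<^typ>\<open>real set\<close> from \<^theory>\<open>HOL-Library.Set_Algebras\<close>; they are elementwise, see
  \<open>set_plus_def\<close> and \<open>set_times_def\<close>.

  A bound \<open>2 \<le> card B\<close> forces \<open>B\<close> to be finite, since \<open>card\<close> is 0 on infinite sets.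
  Nothing is lost when decompositions \<open>A = B + C\<close> of a finite set \<open>A\<close> are considered:
  if \<open>B\<close> and \<open>C\<close> are nonempty, each of them has a translate contained in \<open>A\<close>.
\<close>

end

theory Submission
  imports Defs "HOL-Analysis.Convex" "HOL-Real_Asymp.Real_Asymp"
begin

text \<open>
  Put \<open>W = A - {0}\<close>. For any set \<open>S\<close>, the kernel \<open>r(x - y)\<close> on \<open>S \<times> S\<close>, with \<open>r(d)\<close> the number of
  representations of \<open>d\<close> as a difference, is positive semidefinite, so the trace of its cube is at
  least \<open>E^3 / card S^3\<close>, where \<open>E\<close> is the additive energy of \<open>S\<close>. If \<open>S = W A\<close> has about
  \<open>card A = K\<close> elements and few products with a large set, the Szemeredi-Trotter bound for Cartesian
  products shows that popular differences are rare, and this bounds the trace from above; together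
  \<open>E\<close> is at most about \<open>K powr (97/39)\<close>, and \<open>97/39 < 5/2\<close>. On the other hand, if
  \<open>A = B + C\<close>, then the additive quadruples \<open>w(b\<^sub>i + c\<^sub>j)\<close> give about \<open>K powr (5/2)\<close> distinct
  solutions of \<open>x - y = z - t\<close> in \<open>S\<close>.
\<close>

text \<open>Rarity of popular differences alone is not enough. It bounds the third moment of
  \<open>r\<close> by about \<open>K^3\<close>; the first moment is about \<open>K^2\<close>, so
  Cauchy-Schwarz yields energy \<open>K powr (5/2)\<close>, exactly the size that a decomposition
  forces. The trace of the cube supplies the missing gain: it counts triangles weighted by three
  popularities at once, and the three differences of a triangle sum to zero, a relation that moments
  of \<open>r\<close> do not see. The gain is slight. In integer powers the comparison ends as
  \<open>K^195\<close> against \<open>K^194\<close>, up to logarithms and \<open>P^354\<close> with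
  \<open>P = K powr \<epsilon>\<close>, so \<open>\<epsilon>\<close> has to be below 1/354.

  The lower bound involves \<open>B\<close> and \<open>C\<close> only through
  \<open>card B * card C\<close>, which is at least \<open>K\<close>. A summand with just two
  elements is therefore no special case.\<close>

section \<open>Cauchy-Schwarz, dyadic sums and cubes of Gram matrices\<close>

lemma card_sq_le_collisions:
  assumes "finite X"
  shows "real (card X)^2 \<le> real (card (f ` X)) * real (card {p\<in>X\<times>X. f (fst p) = f (snd p)})"
proof -
  define F where "F = (\<lambda>v. {x\<in>X. f x = v})"
  have fin: "finite (F v)" for v using assms by (simp add: F_def)
  have "X = (\<Union>v\<in>f ` X. F v)" by (auto simp: F_def)
  moreover have "card (\<Union>v\<in>f ` X. F v) = (\<Sum>v\<in>f ` X. card (F v))"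
    by (intro card_UN_disjoint) (use assms fin in \<open>auto simp: F_def\<close>)
  ultimately have 1: "real (card X) = (\<Sum>v\<in>f ` X. real (card (F v)))" by simp
  have "{p\<in>X\<times>X. f (fst p) = f (snd p)} = (\<Union>v\<in>f ` X. F v \<times> F v)"
    by (auto simp: F_def)
  moreover have "card (\<Union>v\<in>f ` X. F v \<times> F v) = (\<Sum>v\<in>f ` X. card (F v \<times> F v))"
    by (intro card_UN_disjoint) (use assms fin in \<open>auto simp: F_def\<close>)
  ultimately have 2: "real (card {p\<in>X\<times>X. f (fst p) = f (snd p)}) = (\<Sum>v\<in>f ` X. real (card (F v))^2)"
    by (simp add: card_cartesian_product power2_eq_square)
  show ?thesis unfolding 1 2 by (subst mult.commute) (rule sum_squared_le_sum_of_squares)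
qed

lemma power_le_sum_dyadic:
  assumes "n < 2^L" "p \<ge> 1"
  shows "real n ^ p \<le> 2^p * (\<Sum>j<L. (2^j)^p * of_bool (2^j \<le> n))"
proof (cases "n = 0")
  case True
  then show ?thesis using assms by (simp add: sum_nonneg power_0_left)
next
  case False
  then obtain j where j: "2^j \<le> n" "n < 2^(j+1)"
    using ex_power_ivl1[of 2 n] by auto
  have "(2::nat)^j < 2^L" using j assms by linarith
  then have jL: "j < L" by simp
  have "real n \<le> 2 * 2^j"
    using j(2) by (metis of_nat_less_iff less_imp_le of_nat_numeral of_nat_power power_add power_one_right mult.commute)
  then have "real n ^ p \<le> (2 * 2^j)^p" by (intro power_mono) auto
  also have "\<dots> = 2^p * ((2^j)^p * of_bool (2^j \<le> n))" using j by (simp add: power_mult_distrib)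
  also have "\<dots> \<le> 2^p * (\<Sum>j<L. (2^j)^p * of_bool (2^j \<le> n))"
    using jL by (intro mult_left_mono member_le_sum) auto
  finally show ?thesis .
qed

text \<open>Every positive value is within a factor 2 of a power of two below it, so a level set
  bound that is uniform in the threshold gives the \<open>p\<close>-th moment at the cost of the
  number \<open>L\<close> of dyadic scales.\<close>

lemma sum_power_le_of_levels:
  fixes f :: "'a \<Rightarrow> nat" and H :: real
  assumes "finite I" "\<And>i. i \<in> I \<Longrightarrow> f i < 2^L" "p \<ge> 1"
    and H: "\<And>t. t \<ge> 1 \<Longrightarrow> real t ^ p * real (card {i\<in>I. t \<le> f i}) \<le> H"
  shows "(\<Sum>i\<in>I. real (f i) ^ p) \<le> 2^p * real L * H"
proof -
  have "(\<Sum>i\<in>I. real (f i) ^ p) \<le> (\<Sum>i\<in>I. 2^p * (\<Sum>j<L. (2^j)^p * of_bool (2^j \<le> f i)))"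
    using assms by (intro sum_mono power_le_sum_dyadic) auto
  also have "\<dots> = 2^p * (\<Sum>j<L. (2^j)^p * (\<Sum>i\<in>I. of_bool (2^j \<le> f i)))"
    unfolding sum_distrib_left by (subst sum.swap) simp
  also have "\<dots> = 2^p * (\<Sum>j<L. (2^j)^p * real (card {i\<in>I. 2^j \<le> f i}))"
    using assms(1) by (simp add: Int_def)
  also have "\<dots> \<le> 2^p * (\<Sum>j<L. H)"
    using H[of "2^_"] by (intro mult_left_mono sum_mono) (auto simp: )
  finally show ?thesis by simp
qed

text \<open>\<open>M\<close> is a Gram matrix. If \<open>m\<close> is its largest eigenvalue, then
  \<open>e \<le> card X * m\<close>, and the trace of the cube of \<open>M\<close> is at least
  \<open>m^3\<close>. The proof replaces the spectrum by three uses of Cauchy-Schwarz, along the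
  vectors \<open>w\<close>, \<open>h\<close>, \<open>k\<close> that arise from the all-ones vector
  by applying the transpose of \<open>F\<close>, then \<open>F\<close>, then the transpose
  again.\<close>

lemma psd_triangle_bound:
  fixes F :: "'a \<Rightarrow> 'b \<Rightarrow> real" and X :: "'a set" and U :: "'b set"
  defines "M \<equiv> \<lambda>x y. \<Sum>u\<in>U. F x u * F y u"
  defines "e \<equiv> \<Sum>x\<in>X. \<Sum>y\<in>X. M x y"
  shows "e^3 \<le> real (card X)^3 * (\<Sum>x\<in>X. \<Sum>y\<in>X. \<Sum>z\<in>X. M x y * M y z * M z x)"
proof -
  define N where "N = real (card X)"
  define w where "w = (\<lambda>u. \<Sum>x\<in>X. F x u)"
  define h where "h = (\<lambda>x. \<Sum>y\<in>X. M x y)"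
  define k where "k = (\<lambda>u. \<Sum>x\<in>X. F x u * h x)"
  define t where "t = (\<Sum>x\<in>X. \<Sum>y\<in>X. \<Sum>z\<in>X. M x y * M y z * M z x)"
  have sym: "M x y = M y x" for x y by (simp add: M_def mult.commute)
  have h_w: "h x = (\<Sum>u\<in>U. F x u * w u)" for x
    unfolding h_def M_def w_def by (subst sum.swap) (simp add: sum_distrib_left)
  have e_w: "e = (\<Sum>u\<in>U. (w u)^2)"
  proof -
    have "e = (\<Sum>x\<in>X. \<Sum>u\<in>U. F x u * w u)" using h_w by (simp add: e_def h_def)
    also have "\<dots> = (\<Sum>u\<in>U. \<Sum>x\<in>X. F x u * w u)" by (rule sum.swap)
    also have "\<dots> = (\<Sum>u\<in>U. (w u)^2)"
      by (simp add: w_def power2_eq_square sum_distrib_right)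
    finally show ?thesis .
  qed
  then have e0: "e \<ge> 0" by (simp add: sum_nonneg)
  have k_M: "k u = (\<Sum>x\<in>X. \<Sum>y\<in>X. M x y * F y u)" for u
  proof -
    have "k u = (\<Sum>y\<in>X. \<Sum>x\<in>X. M x y * F y u)"
      unfolding k_def h_def by (simp add: sum_distrib_left sym mult.commute)
    then show ?thesis by (subst sum.swap) simp
  qed
  have hh: "(\<Sum>x\<in>X. (h x)^2) = (\<Sum>u\<in>U. w u * k u)"
  proof -
    have "(\<Sum>x\<in>X. (h x)^2) = (\<Sum>x\<in>X. \<Sum>u\<in>U. h x * (F x u * w u))"
      by (simp add: power2_eq_square h_w sum_distrib_left[symmetric])
    also have "\<dots> = (\<Sum>u\<in>U. \<Sum>x\<in>X. h x * (F x u * w u))" by (rule sum.swap)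
    finally show ?thesis by (simp add: k_def sum_distrib_left mult_ac)
  qed
  have 1: "e^2 \<le> N * (\<Sum>x\<in>X. (h x)^2)"
    unfolding e_def N_def h_def by (subst mult.commute) (rule sum_squared_le_sum_of_squares)
  have 2: "(\<Sum>x\<in>X. (h x)^2)^2 \<le> e * (\<Sum>u\<in>U. (k u)^2)"
    unfolding hh e_w by (rule Cauchy_Schwarz_ineq_sum)
  have "(\<Sum>u\<in>U. (k u)^2) \<le> (\<Sum>u\<in>U. N * (\<Sum>x\<in>X. (\<Sum>y\<in>X. M x y * F y u)^2))"
    unfolding k_M N_def mult.commute[of "real (card X)"]
    by (intro sum_mono sum_squared_le_sum_of_squares)
  also have "\<dots> = N * (\<Sum>x\<in>X. \<Sum>u\<in>U. \<Sum>y\<in>X. \<Sum>z\<in>X. M x y * M x z * (F y u * F z u))"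
    by (simp add: sum_distrib_left[symmetric] power2_eq_square sum_product mult_ac
        sum.swap[of _ X U])
  also have "(\<Sum>x\<in>X. \<Sum>u\<in>U. \<Sum>y\<in>X. \<Sum>z\<in>X. M x y * M x z * (F y u * F z u)) = t"
    unfolding t_def
  proof (intro sum.cong refl)
    fix x
    have "(\<Sum>u\<in>U. \<Sum>y\<in>X. \<Sum>z\<in>X. M x y * M x z * (F y u * F z u))
        = (\<Sum>y\<in>X. \<Sum>z\<in>X. \<Sum>u\<in>U. M x y * M x z * (F y u * F z u))"
      by (subst sum.swap) (intro sum.cong refl sum.swap)
    also have "\<dots> = (\<Sum>y\<in>X. \<Sum>z\<in>X. M x y * M x z * M y z)"
      by (simp add: M_def sum_distrib_left)
    also have "\<dots> = (\<Sum>y\<in>X. \<Sum>z\<in>X. M x y * M y z * M z x)"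
      by (simp add: sym mult_ac)
    finally show "(\<Sum>u\<in>U. \<Sum>y\<in>X. \<Sum>z\<in>X. M x y * M x z * (F y u * F z u))
        = (\<Sum>y\<in>X. \<Sum>z\<in>X. M x y * M y z * M z x)" .
  qed
  finally have 3: "(\<Sum>u\<in>U. (k u)^2) \<le> N * t" .
  have N0: "N \<ge> 0" by (simp add: N_def)
  have "e * e^3 = (e^2)^2" by (simp add: power2_eq_square power3_eq_cube)
  also have "\<dots> \<le> (N * (\<Sum>x\<in>X. (h x)^2))^2" using 1 by (intro power_mono) auto
  also have "\<dots> = N^2 * (\<Sum>x\<in>X. (h x)^2)^2" by (simp add: power_mult_distrib)
  also have "\<dots> \<le> N^2 * (e * (N * t))"
    using 2 3 e0 by (intro mult_left_mono order.trans[OF 2] mult_left_mono) auto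
  also have "\<dots> = e * (N^3 * t)" by (simp add: power2_eq_square power3_eq_cube)
  finally have main: "e * e^3 \<le> e * (N^3 * t)" .
  show ?thesis
  proof (cases "e = 0")
    case True
    have "0 \<le> (\<Sum>u\<in>U. (k u)^2)" by (simp add: sum_nonneg)
    with 3 have "0 \<le> N * t" by simp
    then have "0 \<le> N^3 * t" using N0
      by (metis mult.assoc mult_nonneg_nonneg power3_eq_cube)
    with True show ?thesis unfolding N_def[symmetric] t_def[symmetric] by simp
  next
    case False
    with main e0 show ?thesis unfolding N_def[symmetric] t_def[symmetric]
      by (simp add: mult_le_cancel_left)
  qed
qed

section \<open>Rich lines in Cartesian products\<close>

text \<open>A cell is a block of \<open>d\<close> consecutive ranks in \<open>X\<close>. Ranks make
  sense for every real number, so \<open>q\<close> is monotone everywhere and not just on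
  \<open>X\<close>.\<close>

lemma ex_mono_cells:
  fixes X :: "real set"
  assumes "finite X" "d \<ge> 1"
  obtains q :: "real \<Rightarrow> nat"
  where "mono q" "\<And>x. x \<in> X \<Longrightarrow> q x * d < card X" "\<And>v. card {x\<in>X. q x = v} \<le> d"
proof
  define rk where "rk = (\<lambda>x::real. card {x'\<in>X. x' < x})"
  define q where "q = (\<lambda>x. rk x div d)"
  have rk_mono: "mono rk"
    unfolding rk_def by (intro monoI card_mono) (use assms in auto)
  then show "mono q"
    by (simp add: q_def mono_def div_le_mono)
  have rk_less: "rk x < rk y" if "x \<in> X" "x < y" for x y
    unfolding rk_def by (intro psubset_card_mono) (use assms that in auto)
  show "q x * d < card X" if "x \<in> X" for x
  proof -
    have "rk x < card X"
      unfolding rk_def by (intro psubset_card_mono) (use assms that in auto)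
    then show ?thesis
      unfolding q_def using div_times_less_eq_dividend[of "rk x" d] by linarith
  qed
  show "card {x\<in>X. q x = v} \<le> d" for v
  proof -
    have "inj_on rk {x\<in>X. q x = v}"
      by (intro linorder_inj_onI') (use rk_less in fastforce)
    moreover have "rk ` {x\<in>X. q x = v} \<subseteq> {v * d..<v * d + d}"
    proof (rule image_subsetI)
      fix x assume "x \<in> {x\<in>X. q x = v}"
      then have "v = rk x div d" by (simp add: q_def)
      then show "rk x \<in> {v * d..<v * d + d}"
        using assms(2) dividend_less_div_times[of d "rk x"] by (simp add: add.commute)
    qed
    ultimately have "card {x\<in>X. q x = v} \<le> card {v * d..<v * d + d}"
      by (intro card_inj_on_le) auto
    then show ?thesis by simp
  qed
qed

lemma card_same_cell_pairs:
  assumes "finite X" "\<And>v. card {x\<in>X. q x = v} \<le> d"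
  shows "card {p\<in>X\<times>X. q (fst p) = q (snd p)} \<le> card X * d"
proof -
  have "{p\<in>X\<times>X. q (fst p) = q (snd p)} = (SIGMA x:X. {x'\<in>X. q x' = q x})" by auto
  then have "card {p\<in>X\<times>X. q (fst p) = q (snd p)} = (\<Sum>x\<in>X. card {x'\<in>X. q x' = q x})"
    using assms by simp
  also have "\<dots> \<le> (\<Sum>x\<in>X. d)" using assms by (intro sum_mono) auto
  finally show ?thesis by simp
qed

text \<open>Choose a representative in each fibre of \<open>h\<close>; every other element forms a
  pair with the representative of its fibre.\<close>

lemma card_le_image_plus_pairs:
  assumes "finite T"
  shows "card T \<le> card (h ` T) + card {p\<in>T\<times>T. fst p \<noteq> snd p \<and> h (fst p) = h (snd p)}"
proof -
  define g where "g = (\<lambda>v. SOME x. x \<in> T \<and> h x = v)"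
  have g: "g (h x) \<in> T \<and> h (g (h x)) = h x" if "x \<in> T" for x
    unfolding g_def by (rule someI[of _ x]) (use that in auto)
  let ?P = "{p\<in>T\<times>T. fst p \<noteq> snd p \<and> h (fst p) = h (snd p)}"
  have "card (T - g ` h ` T) \<le> card ?P"
  proof (rule card_inj_on_le[where f = "\<lambda>x. (x, g (h x))"])
    show "(\<lambda>x. (x, g (h x))) ` (T - g ` h ` T) \<subseteq> ?P"
      using g by auto
    show "finite ?P" using assms by simp
  qed (auto simp: inj_on_def)
  moreover have "card T \<le> card (g ` h ` T) + card (T - g ` h ` T)"
    using card_Un_le[of "g ` h ` T" "T - g ` h ` T"] card_mono[of "g ` h ` T \<union> (T - g ` h ` T)" T] assms
    by fastforce
  moreover have "card (g ` h ` T) \<le> card (h ` T)"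
    using assms by (intro card_image_le) auto
  ultimately show ?thesis by linarith
qed

text \<open>Since a line of positive slope is increasing, it meets at most \<open>p + q - 1\<close> cells of a
  \<open>p \<times> q\<close> grid; the other incidences yield pairs of points in a common cell, and each pair
  lies on one line.\<close>

lemma rich_lines_cells:
  fixes X Y :: "real set" and \<L> :: "(real \<times> real) set"
  assumes fin: "finite X" "finite Y" "finite \<L>" and d: "d \<ge> 1" "e \<ge> 1" and "k \<ge> 1"
    and slope: "\<And>l c. (l, c) \<in> \<L> \<Longrightarrow> l > 0"
    and rich: "\<And>l c. (l, c) \<in> \<L> \<Longrightarrow> k \<le> card {x\<in>X. l * x + c \<in> Y}"
    and cells: "\<And>i j. i * d < card X \<Longrightarrow> j * e < card Y \<Longrightarrow> i + j + 1 + s \<le> k"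
  shows "card \<L> * s \<le> (card X * d) * (card Y * e)"
proof -
  obtain qX where qX: "mono qX" "\<And>x. x \<in> X \<Longrightarrow> qX x * d < card X" "\<And>v. card {x\<in>X. qX x = v} \<le> d"
    using ex_mono_cells[OF fin(1) d(1)] by metis
  obtain qY where qY: "mono qY" "\<And>y. y \<in> Y \<Longrightarrow> qY y * e < card Y" "\<And>v. card {y\<in>Y. qY y = v} \<le> e"
    using ex_mono_cells[OF fin(2) d(2)] by metis
  define T where "T = (\<lambda>(l, c). {x\<in>X. l * x + c \<in> Y})"
  \<comment> \<open>Both cell indices are weakly increasing along a line of positive slope, so equal
    sums force equal indices: \<open>h\<close> labels the cells met by the line without
    repetition.\<close>
  define h where "h = (\<lambda>(l, c) x. qX x + qY (l * x + c))"
  define Pr where "Pr = (\<lambda>z. {p\<in>T z\<times>T z. fst p \<noteq> snd p \<and> h z (fst p) = h z (snd p)})"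
  define PP where "PP = {p\<in>X\<times>X. qX (fst p) = qX (snd p)} \<times> {p\<in>Y\<times>Y. qY (fst p) = qY (snd p)}"
  have finT: "finite (T z)" for z using fin by (auto simp: T_def split: prod.splits)
  have s: "s \<le> card (Pr z)" if z: "z \<in> \<L>" for z
  proof -
    obtain l c where lc: "z = (l, c)" by (cases z)
    have k: "k \<le> card (T z)" using rich z lc by (simp add: T_def)
    have bound: "v + 1 + s \<le> k" if "v \<in> h z ` T z" for v
      using that cells qX(2) qY(2) by (auto simp: lc h_def T_def)
    have "card (h z ` T z) + s \<le> k"
    proof -
      have "T z \<noteq> {}" using k \<open>k \<ge> 1\<close> by auto
      then have "s \<le> k" using bound by force
      have "h z ` T z \<subseteq> {..<k - s}" using bound by force
      then have "card (h z ` T z) \<le> k - s"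
        using card_mono[of "{..<k - s}"] by fastforce
      with \<open>s \<le> k\<close> show ?thesis by linarith
    qed
    with k card_le_image_plus_pairs[OF finT, of z "h z"] show ?thesis
      unfolding Pr_def by linarith
  qed
  have eqs: "qX x = qX x' \<and> qY (l*x+c) = qY (l*x'+c)"
    if "(l, c) \<in> \<L>" "h (l, c) x = h (l, c) x'" for l c x x'
    using that
  proof (induction x x' rule: linorder_wlog)
    case (le x x')
    have "l * x + c \<le> l * x' + c" using slope[OF le(2)] le(1) by (simp add: mult_left_mono)
    then have "qX x \<le> qX x'" "qY (l*x+c) \<le> qY (l*x'+c)"
      using le(1) qX(1) qY(1) by (auto simp: mono_def)
    with le(3) show ?case by (simp add: h_def)
  qed (metis)
  have "card \<L> * s = (\<Sum>z\<in>\<L>. s)" by simp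
  also have "\<dots> \<le> (\<Sum>z\<in>\<L>. card (Pr z))" using s by (intro sum_mono)
  also have "\<dots> = card (SIGMA z:\<L>. Pr z)"
    using fin finT by (simp add: Pr_def)
  also have "\<dots> \<le> card PP"
  proof (rule card_inj_on_le[where f = "\<lambda>((l, c), (x, x')). ((x, x'), (l*x+c, l*x'+c))"])
    show "inj_on (\<lambda>((l, c), (x, x')). ((x, x'), (l*x+c, l*x'+c))) (SIGMA z:\<L>. Pr z)"
    proof (rule inj_onI, clarsimp simp: Pr_def)
      fix l c x x' l' c' :: real
      assume "x \<noteq> x'" and 1: "l * x + c = l' * x + c'" "l * x' + c = l' * x' + c'"
      then have "(l - l') * (x - x') = 0" by (simp add: algebra_simps)
      with \<open>x \<noteq> x'\<close> have "l = l'" by simp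
      with 1 show "l = l' \<and> c = c'" by simp
    qed
    show "(\<lambda>((l, c), (x, x')). ((x, x'), (l*x+c, l*x'+c))) ` (SIGMA z:\<L>. Pr z) \<subseteq> PP"
    proof (rule image_subsetI)
      fix z assume z: "z \<in> (SIGMA z:\<L>. Pr z)"
      obtain l c x x' where zz: "z = ((l, c), (x, x'))" by (metis prod.collapse)
      have "qX x = qX x' \<and> qY (l*x+c) = qY (l*x'+c)"
        using z by (intro eqs) (auto simp: zz Pr_def)
      then show "(\<lambda>((l, c), (x, x')). ((x, x'), (l*x+c, l*x'+c))) z \<in> PP"
        using z by (simp add: zz Pr_def PP_def T_def)
    qed
    show "finite PP" using fin by (simp add: PP_def)
  qed
  also have "\<dots> \<le> (card X * d) * (card Y * e)"
    unfolding PP_def card_cartesian_product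
    using fin qX(3) qY(3) by (intro mult_mono card_same_cell_pairs) auto
  finally show ?thesis .
qed

text \<open>This is the Szemeredi-Trotter rate. With cells of about \<open>card X / k\<close> by
  \<open>card Y / k\<close> points, a fixed proportion of the \<open>k\<close> incidences on each
  line collides, while there are only about \<open>(card X)^2 * (card Y)^2 / k^2\<close> pairs of
  points in a common cell to share among the lines.\<close>

lemma rich_lines_pos:
  fixes X Y :: "real set" and \<L> :: "(real \<times> real) set"
  assumes fin: "finite X" "finite Y" "finite \<L>" and k: "k \<ge> 2"
    and slope: "\<And>l c. (l, c) \<in> \<L> \<Longrightarrow> l > 0"
    and rich: "\<And>l c. (l, c) \<in> \<L> \<Longrightarrow> k \<le> card {x\<in>X. l * x + c \<in> Y}"
  shows "card \<L> * k^3 \<le> 100 * (card X)^2 * (card Y)^2"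
proof (cases "\<L> = {}")
  case False
  then obtain l c where lc: "(l, c) \<in> \<L>" by auto
  define a where "a = card X"
  define b where "b = card Y"
  have "card {x\<in>X. l * x + c \<in> Y} \<le> a"
    unfolding a_def using fin by (intro card_mono) auto
  with rich[OF lc] have ka: "k \<le> a" by simp
  have "card {x\<in>X. l * x + c \<in> Y} \<le> b"
    unfolding b_def using fin slope[OF lc]
    by (intro card_inj_on_le[where f = "\<lambda>x. l * x + c"]) (auto simp: inj_on_def)
  with rich[OF lc] have kb: "k \<le> b" by simp
  show ?thesis
  proof (cases "k \<ge> 4")
    case True
    \<comment> \<open>The factor 4 keeps each cell index at most \<open>k / 4\<close>. The index
      sums are then at most \<open>k / 2\<close>, which leaves at least \<open>k / 4\<close>
      colliding incidences.\<close>
    define d where "d = 4 * a div k + 1"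
    define e where "e = 4 * b div k + 1"
    have "d * k = 4 * a div k * k + k" by (simp add: d_def)
    then have d: "4 * a < d * k" "d * k \<le> 5 * a"
      using k ka div_times_less_eq_dividend[of "4*a" k] dividend_less_div_times[of k "4*a"]
      by linarith+
    have "e * k = 4 * b div k * k + k" by (simp add: e_def)
    then have e: "4 * b < e * k" "e * k \<le> 5 * b"
      using k kb div_times_less_eq_dividend[of "4*b" k] dividend_less_div_times[of k "4*b"]
      by linarith+
    have cell: "4 * i \<le> k" if "i * u < n" "4 * n < u * k" for i u n :: nat
    proof (rule ccontr)
      assume "\<not> 4 * i \<le> k"
      then have "k * u \<le> 4 * i * u" by (intro mult_right_mono) auto
      with that show False by (simp add: mult.commute)
    qed
    define s where "s = k - (k div 2 + 1)"
    have s: "k \<le> 4 * s" "s + (k div 2 + 1) = k" using True by (auto simp: s_def)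
    have "card \<L> * s \<le> (card X * d) * (card Y * e)"
    proof (rule rich_lines_cells[OF fin _ _ _ slope rich])
      fix i j assume "i * d < card X" "j * e < card Y"
      then have "4 * i \<le> k" "4 * j \<le> k" using cell d(1) e(1) by (auto simp: a_def b_def)
      then show "i + j + 1 + s \<le> k" using s(2) by linarith
    qed (use k in \<open>auto simp: d_def e_def\<close>)
    then have 1: "card \<L> * s \<le> (a * d) * (b * e)" by (simp add: a_def b_def)
    have "card \<L> * k^3 = card \<L> * k * k^2" by (simp add: power2_eq_square power3_eq_cube)
    also have "\<dots> \<le> card \<L> * (4 * s) * k^2" using s by (intro mult_mono) auto
    also have "\<dots> = 4 * (card \<L> * s) * k^2" by simp
    also have "\<dots> \<le> 4 * ((a * d) * (b * e)) * k^2" using 1 by (intro mult_right_mono mult_left_mono) auto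
    also have "\<dots> = 4 * a * b * ((d * k) * (e * k))" by (simp add: power2_eq_square)
    also have "\<dots> \<le> 4 * a * b * ((5 * a) * (5 * b))" by (intro mult_left_mono mult_mono[OF d(2) e(2)]) auto
    finally show ?thesis by (simp add: power2_eq_square a_def b_def mult_ac)
  next
    case False
    \<comment> \<open>For small \<open>k\<close> a single cell suffices: two points on a line
      already form a pair, and \<open>k^3 \<le> 27\<close> is absorbed by the constant.\<close>
    have "card \<L> * 1 \<le> (card X * a) * (card Y * b)"
    proof (rule rich_lines_cells[OF fin _ _ _ slope rich])
      fix i j assume "i * a < card X" "j * b < card Y"
      then have "i = 0" "j = 0" by (auto simp: a_def b_def)
      then show "i + j + 1 + 1 \<le> k" using k by simp
    qed (use k ka kb in auto)
    then have 1: "card \<L> \<le> a^2 * b^2" by (simp add: a_def b_def power2_eq_square)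
    have "k^3 \<le> 3^3" using False by (intro power_mono) auto
    then have "card \<L> * k^3 \<le> (a^2 * b^2) * 100" using 1 by (intro mult_mono) auto
    then show ?thesis by (simp add: a_def b_def mult_ac)
  qed
qed simp

lemma rich_lines:
  fixes X Y :: "real set" and \<L> :: "(real \<times> real) set"
  assumes fin: "finite X" "finite Y" "finite \<L>" and k: "k \<ge> 2"
    and slope: "\<And>l c. (l, c) \<in> \<L> \<Longrightarrow> l \<noteq> 0"
    and rich: "\<And>l c. (l, c) \<in> \<L> \<Longrightarrow> k \<le> card {x\<in>X. l * x + c \<in> Y}"
  shows "card \<L> * k^3 \<le> 200 * (card X)^2 * (card Y)^2"
proof -
  define P where "P = {z\<in>\<L>. fst z > 0}"
  define Q where "Q = {z\<in>\<L>. fst z < 0}"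
  define Q' where "Q' = (\<lambda>z. (- fst z, - snd z)) ` Q"
  have "\<L> = P \<union> Q" using slope by (auto simp: P_def Q_def) force
  then have "card \<L> \<le> card P + card Q" by (metis card_Un_le)
  moreover have "card Q' = card Q"
    unfolding Q'_def by (intro card_image) (auto simp: inj_on_def prod_eq_iff)
  moreover have "card P * k^3 \<le> 100 * (card X)^2 * (card Y)^2"
    using fin k rich by (intro rich_lines_pos) (auto simp: P_def)
  moreover have "card Q' * k^3 \<le> 100 * (card X)^2 * (card (uminus ` Y))^2"
  proof (rule rich_lines_pos)
    fix l c assume "(l, c) \<in> Q'"
    then have "(-l, -c) \<in> \<L>" "l > 0" by (auto simp: Q'_def Q_def)
    moreover have "y \<in> uminus ` Y \<longleftrightarrow> - y \<in> Y" for y :: real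
      by force
    then have "{x\<in>X. -l * x + -c \<in> Y} = {x\<in>X. l * x + c \<in> uminus ` Y}"
      by simp
    ultimately show "l > 0" "k \<le> card {x\<in>X. l * x + c \<in> uminus ` Y}"
      using rich[of "-l" "-c"] by auto
  qed (use fin k in \<open>auto simp: Q'_def Q_def\<close>)
  moreover have "card (uminus ` Y) = card Y" by (intro card_image) auto
  ultimately show ?thesis
    using mult_right_mono[of "card \<L>" "card P + card Q" "k^3"] by (simp add: algebra_simps)
qed

section \<open>Popular differences and additive energy\<close>

definition shift_count :: "real set \<Rightarrow> real set \<Rightarrow> real \<Rightarrow> nat" where
  "shift_count S D z = card {v\<in>D. v + z \<in> S}"

lemma shift_count_le_target:
  assumes "finite S"
  shows "shift_count S D z \<le> card S"
  unfolding shift_count_def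
  using assms by (intro card_inj_on_le[where f = "\<lambda>v. v + z"]) (auto simp: inj_on_def)

lemma popular_subset_diffs:
  assumes "t \<ge> 1"
  shows "{z. t \<le> shift_count S D z} \<subseteq> (\<lambda>(x, v). x - v) ` (S \<times> D)"
proof
  fix z assume "z \<in> {z. t \<le> shift_count S D z}"
  with assms have "card {v\<in>D. v + z \<in> S} \<noteq> 0" by (simp add: shift_count_def)
  then have "{v\<in>D. v + z \<in> S} \<noteq> {}" by (metis card.empty)
  then show "z \<in> (\<lambda>(x, v). x - v) ` (S \<times> D)"
    by (force simp: image_iff)
qed

lemma finite_popular:
  assumes "finite S" "finite D" "t \<ge> 1"
  shows "finite {z. t \<le> shift_count S D z}"
  using popular_subset_diffs[OF assms(3)] assms finite_subset by blast

lemma sum_shift_count_le: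
  assumes "finite S" "finite D" "finite Z"
  shows "(\<Sum>z\<in>Z. shift_count S D z) \<le> card S * card D"
proof -
  have "(\<Sum>z\<in>Z. shift_count S D z) = card (SIGMA z:Z. {v\<in>D. v + z \<in> S})"
    using assms by (simp add: shift_count_def)
  also have "\<dots> \<le> card (S \<times> D)"
    using assms by (intro card_inj_on_le[where f = "\<lambda>(z, v). (v + z, v)"]) (auto simp: inj_on_def)
  finally show ?thesis by (simp add: card_cartesian_product)
qed

text \<open>The representations \<open>x = v + z\<close> with \<open>x \<in> S\<close> become, for each \<open>w \<in> W\<close>, incidences of
  points of \<open>D \<times> W S\<close> with the line of slope \<open>w\<close> and intercept \<open>w z\<close>.\<close>

lemma popular_shifts:
  assumes fin: "finite S" "finite W" "finite D" and W: "0 \<notin> W" "card W \<le> card (W * S)" and t: "t \<ge> 1"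
  shows "card W * card {z. t \<le> shift_count S D z} * t^3 \<le> 200 * (card D)^2 * (card (W * S))^2"
proof -
  define Z where "Z = {z. t \<le> shift_count S D z}"
  have finZ: "finite Z" unfolding Z_def using fin t by (intro finite_popular)
  have finU: "finite (W * S)" using fin by (simp add: finite_set_times)
  show ?thesis
  proof (cases "t \<ge> 2")
    case True
    define \<L> where "\<L> = (\<lambda>(w, z). (w, w * z)) ` (W \<times> Z)"
    have "inj_on (\<lambda>(w, z). (w, w * z)) (W \<times> Z)"
      using W by (auto simp: inj_on_def)
    then have "card \<L> = card W * card Z"
      by (simp add: \<L>_def card_image card_cartesian_product)
    moreover have "card \<L> * t^3 \<le> 200 * (card D)^2 * (card (W * S))^2"
    proof (rule rich_lines)
      fix l c assume "(l, c) \<in> \<L>"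
      then obtain z where z: "l \<in> W" "z \<in> Z" "c = l * z" by (auto simp: \<L>_def)
      show "l \<noteq> 0" using z W by auto
      have "t \<le> card {v\<in>D. v + z \<in> S}" using z by (simp add: Z_def shift_count_def)
      also have "\<dots> \<le> card {x\<in>D. l * x + c \<in> W * S}"
        using z fin by (intro card_mono) (auto simp: set_times_def distrib_left[symmetric])
      finally show "t \<le> card {x\<in>D. l * x + c \<in> W * S}" .
    qed (use fin finZ finU True in \<open>auto simp: \<L>_def\<close>)
    ultimately show ?thesis by (simp add: Z_def)
  next
    case False
    \<comment> \<open>Lines with one incidence are beyond the rich line bound. Here the trivial
      count of differences is enough, because \<open>card W\<close> and \<open>card S\<close> are
      both at most \<open>card (W * S)\<close>.\<close>
    with t have t1: "t = 1" by simp
    show ?thesis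
    proof (cases "Z = {}")
      case True
      then show ?thesis by (simp add: Z_def)
    next
      case False
      then have ne: "S \<noteq> {}" "D \<noteq> {}"
        using popular_subset_diffs[OF t, of S D] by (auto simp: Z_def)
      show ?thesis
      proof (cases "W = {}")
        case False
        then obtain w where w: "w \<in> W" by auto
        have SU: "card S \<le> card (W * S)"
          using w W finU by (intro card_inj_on_le[where f = "\<lambda>x. w * x"]) (auto simp: inj_on_def set_times_def)
        have D1: "card D \<ge> 1" using ne fin by (simp add: Suc_le_eq card_gt_0_iff)
      have "card Z \<le> card (S \<times> D)"
        using popular_subset_diffs[OF t, of S D] fin surj_card_le[of "S \<times> D" Z]
        by (simp add: Z_def)
      then have ZSD: "card Z \<le> card S * card D" by (simp add: card_cartesian_product)
        have "card W * card Z * t^3 \<le> card (W * S) * (card (W * S) * card D)"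
          using W(2) SU ZSD t1 by (auto intro!: mult_mono order.trans[OF ZSD])
        also have "\<dots> \<le> (card D)^2 * (card (W * S))^2"
          using D1 by (simp add: power2_eq_square)
        finally show ?thesis by (simp add: Z_def)
      qed simp
    qed
  qed
qed

section \<open>Triangles with popular sides\<close>

text \<open>The differences run around the cycle and sum to zero: two of them determine the third,
  and the three sets can be rotated.\<close>

definition triangles :: "'a::ab_group_add set \<Rightarrow> 'a set \<Rightarrow> 'a set \<Rightarrow> 'a set \<Rightarrow> ('a \<times> 'a \<times> 'a) set" where
  "triangles S P Q R = {(x, y, z). x \<in> S \<and> y \<in> S \<and> z \<in> S \<and> x - y \<in> P \<and> y - z \<in> Q \<and> z - x \<in> R}"

lemma finite_triangles: "finite S \<Longrightarrow> finite (triangles S P Q R)"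
  by (rule finite_subset[of _ "S \<times> S \<times> S"]) (auto simp: triangles_def)

lemma card_triangles_rotate:
  "card (triangles S P Q R) = card (triangles S Q R P)"
  by (rule bij_betw_same_card[of "\<lambda>(x, y, z). (y, z, x)"],
      rule bij_betwI[of _ _ _ "\<lambda>(y, z, x). (x, y, z)"]) (auto simp: triangles_def)

lemma triangles_trivial_bound:
  assumes "finite S" "finite P" "finite Q"
  shows "card (triangles S P Q R) \<le> card S * (card P * card Q)"
proof -
  have "card (triangles S P Q R) \<le> card (S \<times> (P \<times> Q))"
    using assms
    by (intro card_inj_on_le[where f = "\<lambda>(x, y, z). (x, (x - y, y - z))"])
      (auto simp: triangles_def inj_on_def)
  then show ?thesis by (simp add: card_cartesian_product)
qed

text \<open>Cauchy-Schwarz for the map from a triangle to its shape \<open>(x - y, y - z)\<close>.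
  Triangles of equal shape are translates, and a translation by \<open>d\<close> moves each of three
  vertices within \<open>S\<close>, whence the third moment. A shape \<open>(p, q)\<close> has
  \<open>- p - q\<close> in \<open>R\<close>, so at least \<open>t\<close> elements \<open>a\<close>
  of \<open>S\<close> have \<open>a - p - q\<close> in \<open>S\<close>; with
  \<open>z = a - p\<close>, both \<open>p + z\<close> and \<open>- q + z\<close> lie in
  \<open>S\<close>, whence the second sum.\<close>

lemma triangles_sq_le:
  assumes "finite S" "finite P" "finite Q" "finite D" "(\<lambda>(x, y). x - y) ` (S \<times> S) \<subseteq> D"
    and R: "\<And>d. d \<in> R \<Longrightarrow> t \<le> shift_count S S d"
    and Z: "finite Z" "(\<lambda>(x, p). x - p) ` (S \<times> P) \<subseteq> Z"
  shows "real (card (triangles S P Q R))^2 * real t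
     \<le> (\<Sum>d\<in>D. real (shift_count S S d)^3)
       * (\<Sum>z\<in>Z. real (shift_count S P z) * real (shift_count S (uminus ` Q) z))"
proof -
  define T where "T = triangles S P Q R"
  define f where "f = (\<lambda>(x::real, y, z::real). (x - y, y - z))"
  define Y where "Y = f ` T"
  define V where "V = (\<lambda>d. {v\<in>S. v + d \<in> S})"
  have finT: "finite T" using assms by (simp add: T_def finite_triangles)
  have finY: "finite Y" using finT by (simp add: Y_def)
  have finV: "finite (V d)" for d using assms by (simp add: V_def)
  have coll: "card {p\<in>T\<times>T. f (fst p) = f (snd p)} \<le> (\<Sum>d\<in>D. (shift_count S S d)^3)"
  proof -
    have "card {p\<in>T\<times>T. f (fst p) = f (snd p)} \<le> card (SIGMA d:D. V d \<times> V d \<times> V d)"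
    proof (rule card_inj_on_le)
      let ?g = "\<lambda>((x, y, z), (x', y', z')). (x' - x, x, y, z :: real)"
      show "inj_on ?g {p\<in>T\<times>T. f (fst p) = f (snd p)}"
        by (auto simp: inj_on_def f_def)
      show "?g ` {p\<in>T\<times>T. f (fst p) = f (snd p)} \<subseteq> (SIGMA d:D. V d \<times> V d \<times> V d)"
      proof (rule image_subsetI)
        fix p assume p: "p \<in> {p\<in>T\<times>T. f (fst p) = f (snd p)}"
        obtain x y z x' y' z' where pp: "p = ((x, y, z), (x', y', z'))"
          by (metis prod.collapse)
        have "x \<in> S" "y \<in> S" "z \<in> S" "x' \<in> S" "y' \<in> S" "z' \<in> S"
          and "y + (x' - x) = y'" "z + (x' - x) = z'"
          using p by (auto simp: pp f_def T_def triangles_def)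
        moreover from this have "x' - x \<in> D" using assms(5) by auto
        ultimately show "?g p \<in> (SIGMA d:D. V d \<times> V d \<times> V d)"
          by (simp add: pp V_def)
      qed
      show "finite (SIGMA d:D. V d \<times> V d \<times> V d)" using assms finV by auto
    qed
    also have "\<dots> = (\<Sum>d\<in>D. (shift_count S S d)^3)"
      using assms finV by (simp add: card_cartesian_product shift_count_def V_def power3_eq_cube mult.assoc)
    finally show ?thesis .
  qed
  have YQ: "card Y * t \<le> (\<Sum>z\<in>Z. shift_count S P z * shift_count S (uminus ` Q) z)"
  proof -
    have "card Y * t = (\<Sum>q\<in>Y. t)" by simp
    also have "\<dots> \<le> (\<Sum>q\<in>Y. card (V (- fst q - snd q)))"
    proof (rule sum_mono)
      fix q assume "q \<in> Y"
      then have "- fst q - snd q \<in> R" by (auto simp: Y_def f_def T_def triangles_def)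
      from R[OF this] show "t \<le> card (V (- fst q - snd q))"
        by (simp add: shift_count_def V_def)
    qed
    also have "\<dots> = card (SIGMA q:Y. V (- fst q - snd q))"
      using finY finV by simp
    also have "\<dots> \<le> card (SIGMA z:Z. {v\<in>P. v + z \<in> S} \<times> {v\<in>uminus ` Q. v + z \<in> S})"
    proof (rule card_inj_on_le)
      let ?g = "\<lambda>((p, q), a). (a - p :: real, p, - q :: real)"
      show "inj_on ?g (SIGMA q:Y. V (- fst q - snd q))"
        by (auto simp: inj_on_def)
      show "?g ` (SIGMA q:Y. V (- fst q - snd q))
          \<subseteq> (SIGMA z:Z. {v\<in>P. v + z \<in> S} \<times> {v\<in>uminus ` Q. v + z \<in> S})"
      proof (rule image_subsetI)
        fix u assume u: "u \<in> (SIGMA q:Y. V (- fst q - snd q))"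
        obtain p q a where pq: "u = ((p, q), a)" by (metis prod.collapse)
        have "p \<in> P" "q \<in> Q" "a \<in> S" "a + (- p - q) \<in> S"
          using u by (auto simp: pq Y_def f_def T_def triangles_def V_def)
        moreover from this have "a - p \<in> Z" using Z(2) by auto
        ultimately show "?g u \<in> (SIGMA z:Z. {v\<in>P. v + z \<in> S} \<times> {v\<in>uminus ` Q. v + z \<in> S})"
          by (simp add: pq algebra_simps)
      qed
      show "finite (SIGMA z:Z. {v\<in>P. v + z \<in> S} \<times> {v\<in>uminus ` Q. v + z \<in> S})"
        using assms Z by auto
    qed
    also have "\<dots> = (\<Sum>z\<in>Z. shift_count S P z * shift_count S (uminus ` Q) z)"
      using assms Z by (simp add: card_cartesian_product shift_count_def)
    finally show ?thesis .
  qed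
  have "real (card T)^2 \<le> real (card Y) * real (card {p\<in>T\<times>T. f (fst p) = f (snd p)})"
    unfolding Y_def by (rule card_sq_le_collisions[OF finT])
  also have "\<dots> \<le> real (card Y) * (\<Sum>d\<in>D. real (shift_count S S d)^3)"
    using coll by (intro mult_left_mono) (auto simp flip: of_nat_power of_nat_sum)
  finally have "real (card T)^2 * real t \<le> (real (card Y) * (\<Sum>d\<in>D. real (shift_count S S d)^3)) * real t"
    by (intro mult_right_mono) auto
  also have "\<dots> = (\<Sum>d\<in>D. real (shift_count S S d)^3) * real (card Y * t)" by simp
  also have "\<dots> \<le> (\<Sum>d\<in>D. real (shift_count S S d)^3)
       * (\<Sum>z\<in>Z. real (shift_count S P z) * real (shift_count S (uminus ` Q) z))"
    using YQ by (intro mult_left_mono sum_nonneg) (auto simp flip: of_nat_mult of_nat_sum)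
  finally show ?thesis unfolding T_def .
qed

text \<open>Rarity is required for all \<open>D\<close>, since it is applied to sets of popular
  differences as well as to \<open>S\<close>. In the application \<open>G\<close> is of the order of
  \<open>card S\<close> up to small losses, and \<open>L\<close> counts dyadic scales.\<close>

locale rare_differences =
  fixes S :: "real set" and G :: real and L :: nat
  assumes fin: "finite S" and card_less: "card S < 2^L"
    and rare: "\<And>D t. finite D \<Longrightarrow> t \<ge> 1 \<Longrightarrow>
      real t^3 * real (card {z. t \<le> shift_count S D z}) \<le> G * real (card D)^2"
begin

abbreviation "N \<equiv> real (card S)"
abbreviation "r \<equiv> shift_count S S"
abbreviation "pop t \<equiv> {d. t \<le> r d}"

lemma G_nonneg: "G \<ge> 0"
proof -
  have "0 \<le> G * real (card {0::real})^2"
    by (rule order.trans[OF _ rare[of "{0}" 1]]) auto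
  then show ?thesis by simp
qed

lemma count_less: "shift_count S D z < 2^L"
  using shift_count_le_target[OF fin] card_less le_less_trans by blast

lemma third_energy_bound:
  assumes "finite D"
  shows "(\<Sum>d\<in>D. real (r d)^3) \<le> 8 * L * (G * N^2)"
proof -
  have "(\<Sum>d\<in>D. real (r d)^3) \<le> 2^3 * real L * (G * N^2)"
  proof (rule sum_power_le_of_levels)
    fix t :: nat assume t: "t \<ge> 1"
    have "card {i\<in>D. t \<le> r i} \<le> card (pop t)"
      using finite_popular[OF fin fin t] by (intro card_mono) auto
    then have "real t^3 * real (card {i\<in>D. t \<le> r i}) \<le> real t^3 * real (card (pop t))"
      by (intro mult_left_mono) auto
    also have "\<dots> \<le> G * N^2" by (rule rare[OF fin t])
    finally show "real t^3 * real (card {i\<in>D. t \<le> r i}) \<le> G * N^2" .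
  qed (use assms count_less in auto)
  then show ?thesis by simp
qed

text \<open>A level set of size \<open>c\<close> obeys both \<open>t * c \<le> N * card D\<close>,
  by counting pairs, and the rarity bound for \<open>t^3 * c\<close>. Their geometric mean controls
  \<open>t^2 * c\<close>; squaring the conclusion removes the root.\<close>

lemma mixed_energy_bound:
  assumes D: "finite D" and Z: "finite Z"
  shows "(\<Sum>z\<in>Z. real (shift_count S D z)^2)^2 \<le> 16 * L^2 * (G * N * real (card D)^3)"
proof -
  define H where "H = sqrt (G * N * real (card D)^3)"
  have H2: "H^2 = G * N * real (card D)^3" using G_nonneg by (simp add: H_def)
  have "(\<Sum>z\<in>Z. real (shift_count S D z)^2) \<le> 2^2 * real L * H"
  proof (rule sum_power_le_of_levels)
    fix t :: nat assume t: "t \<ge> 1"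
    define c where "c = real (card {z. t \<le> shift_count S D z})"
    have finP: "finite {z. t \<le> shift_count S D z}" using finite_popular[OF fin D t] .
    have "card {z. t \<le> shift_count S D z} * t \<le> (\<Sum>z | t \<le> shift_count S D z. shift_count S D z)"
      using sum_bounded_below[of "{z. t \<le> shift_count S D z}" t "shift_count S D"] by simp
    also have "\<dots> \<le> card S * card D" using fin D finP by (rule sum_shift_count_le)
    finally have 1: "t * c \<le> N * card D"
      by (simp add: c_def mult.commute flip: of_nat_mult)
    have "(real t^2 * c)^2 = (real t^3 * c) * (t * c)"
      by (simp add: power2_eq_square power3_eq_cube)
    also have "\<dots> \<le> (G * real (card D)^2) * (N * card D)"
      using rare[OF D t] 1 G_nonneg by (intro mult_mono[of "real t^3 * c"]) (auto simp: c_def)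
    also have "\<dots> = H^2" unfolding H2 by algebra
    finally have "real t^2 * c \<le> H"
      by (rule power2_le_imp_le) (use G_nonneg in \<open>simp add: H_def\<close>)
    moreover have "card {i\<in>Z. t \<le> shift_count S D i} \<le> card {z. t \<le> shift_count S D z}"
      using finP by (intro card_mono) auto
    then have "real t^2 * real (card {i\<in>Z. t \<le> shift_count S D i}) \<le> real t^2 * c"
      by (intro mult_left_mono) (auto simp: c_def)
    ultimately show "real t^2 * real (card {i\<in>Z. t \<le> shift_count S D i}) \<le> H" by linarith
  qed (use Z count_less in auto)
  then have "(\<Sum>z\<in>Z. real (shift_count S D z)^2)^2 \<le> (4 * real L * H)^2"
    by (intro power_mono sum_nonneg) auto
  then show ?thesis by (simp add: power_mult_distrib H2)
qed

text \<open>Two estimates compete. \<open>T8\<close>, from \<open>triangles_sq_le\<close>, is strong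
  when the least threshold \<open>c\<close> is small; \<open>T1\<close>, from choosing one vertex
  and two popular differences, is strong when \<open>c\<close> is large. Their product with suitable
  exponents is free of \<open>c\<close>.\<close>

lemma triangles_bound_ordered:
  assumes t: "a \<ge> 1" "b \<ge> 1" "c \<ge> 1" "c \<le> a" "c \<le> b"
  shows "(real (a * b * c) * real (card (triangles S (pop a) (pop b) (pop c))))^26
     \<le> 2^60 * L^24 * G^40 * N^76"
proof -
  define x where "x = real (card (triangles S (pop a) (pop b) (pop c)))"
  define T where "T = real (a * b * c) * x"
  define p where "p = real (card (pop a))"
  define q where "q = real (card (pop b))"
  define D where "D = (\<lambda>(x, y). x - y) ` (S \<times> S)"
  define Z where "Z = (\<lambda>(x, y). x - y) ` (S \<times> pop a)"
  define E where "E = (\<Sum>d\<in>D. real (r d)^3)"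
  define M where "M = (\<Sum>z\<in>Z. real (shift_count S (pop a) z) * real (shift_count S (uminus ` pop b) z))"
  define A where "A = real a"
  define B where "B = real b"
  define C where "C = real c"
  define K where "K = G * N^2"
  have fp: "finite (pop a)" "finite (pop b)" using finite_popular[OF fin fin] t by auto
  have finD: "finite D" and finZ: "finite Z" using fin fp by (auto simp: D_def Z_def)
  have pos: "A > 0" "B > 0" "C > 0" "C \<le> A" "C \<le> B" using t by (auto simp: A_def B_def C_def)
  have nn: "x \<ge> 0" "p \<ge> 0" "q \<ge> 0" "E \<ge> 0" "M \<ge> 0" "K \<ge> 0" "N \<ge> 0" "G \<ge> 0"
    using G_nonneg by (auto simp: x_def p_def q_def E_def M_def K_def intro!: sum_nonneg)
  have 1: "x^2 * C \<le> E * M"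
    unfolding x_def E_def M_def C_def
    by (rule triangles_sq_le[OF fin fp finD _ _ finZ]) (auto simp: D_def Z_def)
  have E: "E \<le> 8 * L * K"
    unfolding E_def K_def by (rule third_energy_bound[OF finD])
  have M: "M^4 \<le> (16 * L^2 * (G * N * p^3)) * (16 * L^2 * (G * N * q^3))"
  proof -
    have "M^4 = (M^2)^2" by simp
    also have "M^2 \<le> (\<Sum>z\<in>Z. real (shift_count S (pop a) z)^2) * (\<Sum>z\<in>Z. real (shift_count S (uminus ` pop b) z)^2)"
      unfolding M_def by (rule Cauchy_Schwarz_ineq_sum)
    then have "(M^2)^2 \<le> ((\<Sum>z\<in>Z. real (shift_count S (pop a) z)^2) * (\<Sum>z\<in>Z. real (shift_count S (uminus ` pop b) z)^2))^2"
      by (intro power_mono) auto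
    also have "\<dots> = (\<Sum>z\<in>Z. real (shift_count S (pop a) z)^2)^2 * (\<Sum>z\<in>Z. real (shift_count S (uminus ` pop b) z)^2)^2"
      by (rule power_mult_distrib)
    also have "\<dots> \<le> (16 * L^2 * (G * N * real (card (pop a))^3)) * (16 * L^2 * (G * N * real (card (uminus ` pop b))^3))"
      using fp finZ G_nonneg by (intro mult_mono mixed_energy_bound) auto
    also have "card (uminus ` pop b) = card (pop b)" by (intro card_image) auto
    finally show ?thesis by (simp add: p_def q_def)
  qed
  have pA: "A^3 * p \<le> K" and qB: "B^3 * q \<le> K"
    unfolding A_def B_def p_def q_def K_def using rare[OF fin] t by auto
  have pq: "(A*B)^3 * (p * q) \<le> K^2"
  proof -
    have "(A*B)^3 * (p * q) = (A^3 * p) * (B^3 * q)" by (simp add: power_mult_distrib)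
    also have "\<dots> \<le> K * K" using pA qB nn pos by (intro mult_mono) auto
    finally show ?thesis by (simp add: power2_eq_square)
  qed
  have C2: "C^2 \<le> A * B" unfolding power2_eq_square using pos by (intro mult_mono) auto
  have x0: "x \<le> N * (p * q)"
    unfolding x_def p_def q_def
    using triangles_trivial_bound[OF fin fp] by (simp flip: of_nat_mult)
  define H where "H = 2^20 * real L^8 * G^12 * N^22"
  have H0: "H \<ge> 0" using nn by (simp add: H_def)
  have T_eq: "T = A * B * C * x" by (simp add: T_def A_def B_def C_def)
  have T0: "T \<ge> 0" using pos nn by (simp add: T_eq)
  \<comment> \<open>Absorbing \<open>(p * q)^3\<close> by \<open>pq\<close> takes
    \<open>(A*B)^9\<close>, but \<open>T^8\<close> supplies only \<open>(A*B)^8\<close>. The missing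
    factor is borrowed through \<open>C^2 \<le> A * B\<close>, which leaves \<open>C^2\<close> in
    the bound.\<close>
  have T8: "T^8 \<le> C^2 * H"
  proof -
    have "C^4 * x^8 = (x^2 * C)^4" by (simp add: power_mult_distrib flip: power_mult)
    also have "\<dots> \<le> (E * M)^4" using 1 nn pos by (intro power_mono) auto
    also have "\<dots> = E^4 * M^4" by (rule power_mult_distrib)
    also have "\<dots> \<le> (8 * L * K)^4 * ((16 * L^2 * (G * N * p^3)) * (16 * L^2 * (G * N * q^3)))"
      using E M nn by (intro mult_mono power_mono) auto
    also have "\<dots> = 2^20 * L^8 * K^4 * (G * N)^2 * (p * q)^3"
      unfolding of_nat_mult of_nat_power of_nat_numeral by algebra
    finally have 2: "C^4 * x^8 \<le> 2^20 * L^8 * K^4 * (G * N)^2 * (p * q)^3" .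
    have "C^2 * (A*B)^9 * (C^4 * x^8) \<le> C^2 * (A*B)^9 * (2^20 * L^8 * K^4 * (G * N)^2 * (p * q)^3)"
      using 2 pos by (intro mult_left_mono) auto
    also have "\<dots> = C^2 * (2^20 * L^8 * K^4 * (G * N)^2) * ((A*B)^3 * (p * q))^3"
      by (simp add: power_mult_distrib flip: power_mult)
    also have "\<dots> \<le> C^2 * (2^20 * L^8 * K^4 * (G * N)^2) * (K^2)^3"
      using pq nn pos by (intro mult_left_mono power_mono) auto
    also have "\<dots> = C^2 * H"
      unfolding K_def H_def of_nat_mult of_nat_power of_nat_numeral by algebra
    finally have 3: "C^2 * (A*B)^9 * (C^4 * x^8) \<le> C^2 * H" .
    have "C^2 * T^8 = C^2 * (C^4 * (A*B)^8 * (C^4 * x^8))"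
      unfolding T_eq by algebra
    also have "\<dots> \<le> (A*B) * (C^4 * (A*B)^8 * (C^4 * x^8))"
      using C2 pos nn by (intro mult_right_mono) auto
    also have "\<dots> = C^2 * (C^2 * (A*B)^9 * (C^4 * x^8))"
      by algebra
    also have "\<dots> \<le> C^2 * (C^2 * H)" using 3 by (intro mult_left_mono) auto
    finally show ?thesis by (rule mult_left_le_imp_le) (use pos in simp)
  qed
  have T1: "C^3 * T \<le> N * K^2"
  proof -
    have "C^4 = (C^2)^2" by simp
    also have "\<dots> \<le> (A*B)^2" using C2 by (intro power_mono) auto
    finally have "C^4 \<le> (A*B)^2" .
    then have "C^3 * T \<le> (A*B)^2 * (A*B*x)"
      using pos nn mult_right_mono[of "C^4" "(A*B)^2" "A*B*x"]
      by (simp add: T_eq power_numeral_reduce mult_ac)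
    also have "\<dots> \<le> (A*B)^2 * (A*B*(N * (p * q)))"
      using x0 pos by (intro mult_left_mono) auto
    also have "\<dots> = N * ((A*B)^3 * (p * q))" by (simp add: power2_eq_square power3_eq_cube)
    also have "\<dots> \<le> N * K^2" using pq nn by (intro mult_left_mono) auto
    finally show ?thesis .
  qed
  \<comment> \<open>The weights 3 and 2 make the powers of \<open>C\<close> cancel; this is the
    origin of \<open>26 = 3 * 8 + 2\<close>.\<close>
  have "C^6 * T^26 = (T^8)^3 * (C^3 * T)^2"
    by (simp add: power_mult_distrib flip: power_mult power_add)
  also have "\<dots> \<le> (C^2 * H)^3 * (N * K^2)^2"
    using T0 H0 nn pos by (intro mult_mono[OF power_mono[OF T8] power_mono[OF T1]]) auto
  also have "\<dots> = C^6 * (H^3 * (N * K^2)^2)"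
    by (simp add: power_mult_distrib flip: power_mult)
  finally have "T^26 \<le> H^3 * (N * K^2)^2" using pos by simp
  also have "\<dots> = 2^60 * L^24 * G^40 * N^76"
    unfolding H_def K_def of_nat_mult of_nat_power of_nat_numeral by algebra
  finally show ?thesis by (simp add: T_def x_def)
qed

lemma triangles_bound:
  assumes t: "a \<ge> 1" "b \<ge> 1" "c \<ge> 1"
  shows "(real (a * b * c) * real (card (triangles S (pop a) (pop b) (pop c))))^26
     \<le> 2^60 * L^24 * G^40 * N^76"
proof -
  consider "c \<le> a \<and> c \<le> b" | "a \<le> b \<and> a \<le> c" | "b \<le> c \<and> b \<le> a" by linarith
  then show ?thesis
  proof cases
    case 1
    then show ?thesis using triangles_bound_ordered[of a b c] t by auto
  next
    case 2
    then show ?thesis using triangles_bound_ordered[of b c a] t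
      by (simp add: card_triangles_rotate[of S "pop a"] mult_ac)
  next
    case 3
    then show ?thesis using triangles_bound_ordered[of c a b] t
      by (simp add: card_triangles_rotate[of S "pop c"] mult_ac)
  qed
qed

end

section \<open>Energy and the cube of the difference kernel\<close>

text \<open>Additive energy as the sum of all entries of the kernel, the form of \<open>e\<close> in
  \<open>psd_triangle_bound\<close>.\<close>

definition energy :: "real set \<Rightarrow> real" where
  "energy S = (\<Sum>x\<in>S. \<Sum>y\<in>S. real (shift_count S S (x - y)))"

text \<open>Substituting \<open>v = y - u\<close> shows that \<open>r (x - y)\<close> is the inner
  product of the indicators of \<open>x - u \<in> S\<close> and \<open>y - u \<in> S\<close> as
  functions of \<open>u\<close>, so the kernel is a Gram matrix. Only \<open>u\<close> in the
  difference set of \<open>S\<close> contribute.\<close>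

lemma energy_cube_le_triangle_sum:
  assumes "finite S"
  defines "r \<equiv> shift_count S S"
  shows "energy S^3 \<le> real (card S)^3 *
    (\<Sum>x\<in>S. \<Sum>y\<in>S. \<Sum>z\<in>S. real (r (x - y)) * real (r (y - z)) * real (r (z - x)))"
proof -
  define U where "U = (\<lambda>(x, y). x - y) ` (S \<times> S)"
  define F where "F = (\<lambda>x u. of_bool (x - u \<in> S) :: real)"
  have finU: "finite U" using assms by (simp add: U_def)
  have M: "(\<Sum>u\<in>U. F x u * F y u) = real (r (x - y))" if "x \<in> S" "y \<in> S" for x y
  proof -
    have "(\<Sum>u\<in>U. F x u * F y u) = (\<Sum>u\<in>U. of_bool (x - u \<in> S \<and> y - u \<in> S))"
      by (simp add: F_def of_bool_conj)
    also have "\<dots> = real (card {u\<in>U. x - u \<in> S \<and> y - u \<in> S})"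
      using finU by (simp add: Int_def)
    also have "card {u\<in>U. x - u \<in> S \<and> y - u \<in> S} = card {v\<in>S. v + (x - y) \<in> S}"
    proof (rule bij_betw_same_card[of "\<lambda>u. y - u"], rule bij_betwI[of _ _ _ "\<lambda>v. y - v"])
      show "(\<lambda>v. y - v) \<in> {v\<in>S. v + (x - y) \<in> S} \<rightarrow> {u\<in>U. x - u \<in> S \<and> y - u \<in> S}"
        using that by (auto simp: U_def algebra_simps)
    qed auto
    finally show ?thesis by (simp add: r_def shift_count_def)
  qed
  have "(\<Sum>x\<in>S. \<Sum>y\<in>S. \<Sum>u\<in>U. F x u * F y u)^3 \<le> real (card S)^3 *
    (\<Sum>x\<in>S. \<Sum>y\<in>S. \<Sum>z\<in>S. (\<Sum>u\<in>U. F x u * F y u) * (\<Sum>u\<in>U. F y u * F z u) * (\<Sum>u\<in>U. F z u * F x u))"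
    by (rule psd_triangle_bound)
  then show ?thesis by (simp add: M energy_def r_def)
qed

context rare_differences
begin

text \<open>Each of the three factors is cut into dyadic levels: the 8 is a factor 2 per side, and
  \<open>L^3\<close> is the number of triples of scales.\<close>

lemma triangle_sum_le:
  assumes R: "\<And>a b c. a \<ge> 1 \<Longrightarrow> b \<ge> 1 \<Longrightarrow> c \<ge> 1 \<Longrightarrow>
      real (a * b * c) * real (card (triangles S (pop a) (pop b) (pop c))) \<le> R"
  shows "(\<Sum>x\<in>S. \<Sum>y\<in>S. \<Sum>z\<in>S. real (r (x - y)) * real (r (y - z)) * real (r (z - x)))
    \<le> 8 * real L^3 * R"
proof -
  define \<chi> where "\<chi> = (\<lambda>j d. of_bool (2^j \<le> r d) :: real)"
  have r: "real (r d) \<le> 2 * (\<Sum>j<L. 2^j * \<chi> j d)" for d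
    using power_le_sum_dyadic[of "r d" L 1] count_less by (simp add: \<chi>_def)
  have prod3: "(2 * sum f {..<L}) * (2 * sum g {..<L}) * (2 * sum h {..<L})
      = (\<Sum>i<L. \<Sum>j<L. \<Sum>k<L. 8 * (f i * g j * h k))" for f g h :: "nat \<Rightarrow> real"
    by (simp add: mult.assoc flip: sum_distrib_left sum_distrib_right)
  have "(\<Sum>x\<in>S. \<Sum>y\<in>S. \<Sum>z\<in>S. real (r (x - y)) * real (r (y - z)) * real (r (z - x)))
     = (\<Sum>(x, y, z)\<in>S\<times>S\<times>S. real (r (x - y)) * real (r (y - z)) * real (r (z - x)))"
    by (simp add: sum.cartesian_product)
  also have "\<dots> \<le> (\<Sum>(x, y, z)\<in>S\<times>S\<times>S. (2 * (\<Sum>i<L. 2^i * \<chi> i (x - y)))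
      * (2 * (\<Sum>j<L. 2^j * \<chi> j (y - z))) * (2 * (\<Sum>k<L. 2^k * \<chi> k (z - x))))"
  proof (intro sum_mono, clarify)
    fix x y z
    have nn: "0 \<le> 2 * (\<Sum>j<L. 2^j * \<chi> j d)" for d
      by (intro mult_nonneg_nonneg sum_nonneg) (auto simp: \<chi>_def)
    show "real (r (x - y)) * real (r (y - z)) * real (r (z - x))
        \<le> (2 * (\<Sum>i<L. 2^i * \<chi> i (x - y))) * (2 * (\<Sum>j<L. 2^j * \<chi> j (y - z)))
          * (2 * (\<Sum>k<L. 2^k * \<chi> k (z - x)))"
      by (intro mult_mono[OF mult_mono[OF r r] r] mult_nonneg_nonneg nn) auto
  qed
  also have "\<dots> = (\<Sum>(x, y, z)\<in>S\<times>S\<times>S. \<Sum>i<L. \<Sum>j<L. \<Sum>k<L.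
      8 * (2^i * 2^j * 2^k) * (\<chi> i (x - y) * \<chi> j (y - z) * \<chi> k (z - x)))"
  proof (intro sum.cong refl, clarify)
    fix x y z
    show "(2 * (\<Sum>i<L. 2^i * \<chi> i (x - y))) * (2 * (\<Sum>j<L. 2^j * \<chi> j (y - z)))
          * (2 * (\<Sum>k<L. 2^k * \<chi> k (z - x)))
        = (\<Sum>i<L. \<Sum>j<L. \<Sum>k<L.
            8 * (2^i * 2^j * 2^k) * (\<chi> i (x - y) * \<chi> j (y - z) * \<chi> k (z - x)))"
      using prod3[of "\<lambda>i. 2^i * \<chi> i (x - y)" "\<lambda>j. 2^j * \<chi> j (y - z)" "\<lambda>k. 2^k * \<chi> k (z - x)"]
      by (simp add: mult_ac)
  qed
  also have "\<dots> = (\<Sum>i<L. \<Sum>j<L. \<Sum>k<L. 8 * (2^i * 2^j * 2^k) *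
      (\<Sum>(x, y, z)\<in>S\<times>S\<times>S. \<chi> i (x - y) * \<chi> j (y - z) * \<chi> k (z - x)))"
    by (simp add: case_prod_unfold sum_distrib_left sum.swap[of _ _ "S\<times>S\<times>S"])
  also have "\<dots> \<le> (\<Sum>i<L. \<Sum>j<L. \<Sum>k<L. 8 * R)"
  proof (intro sum_mono)
    fix i j k
    have "(\<Sum>(x, y, z)\<in>S\<times>S\<times>S. \<chi> i (x - y) * \<chi> j (y - z) * \<chi> k (z - x))
        = (\<Sum>p\<in>S\<times>S\<times>S. of_bool (p \<in> triangles S (pop (2^i)) (pop (2^j)) (pop (2^k))))"
      by (intro sum.cong refl) (auto simp: \<chi>_def triangles_def)
    also have "\<dots> = real (card (triangles S (pop (2^i)) (pop (2^j)) (pop (2^k))))"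
      using fin by (simp add: Int_def) (intro arg_cong[where f = card], auto simp: triangles_def)
    finally show "8 * (2^i * 2^j * 2^k) *
        (\<Sum>(x, y, z)\<in>S\<times>S\<times>S. \<chi> i (x - y) * \<chi> j (y - z) * \<chi> k (z - x)) \<le> 8 * R"
      using R[of "2^i" "2^j" "2^k"] by simp
  qed
  also have "\<dots> = 8 * real L^3 * R" by (simp add: power3_eq_cube)
  finally show ?thesis .
qed

text \<open>The power \<open>78 = 3 * 26\<close> clears the cube and the 26th root. With
  \<open>G\<close> and \<open>N\<close> of order \<open>K\<close>, the right side is
  \<open>K^194\<close> up to logarithms, and \<open>194/78 = 97/39\<close>.\<close>

lemma energy_bound: "energy S^78 \<le> 2^138 * real L^102 * G^40 * N^154"
proof -
  define X where "X = 2^60 * real L^24 * G^40 * N^76"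
  define R where "R = root 26 X"
  define t where "t = (\<Sum>x\<in>S. \<Sum>y\<in>S. \<Sum>z\<in>S. real (r (x - y)) * real (r (y - z)) * real (r (z - x)))"
  have X0: "X \<ge> 0" using G_nonneg by (simp add: X_def)
  have "t \<le> 8 * real L^3 * R"
    unfolding t_def
  proof (rule triangle_sum_le)
    fix a b c :: nat
    assume "a \<ge> 1" "b \<ge> 1" "c \<ge> 1"
    then have "(real (a * b * c) * real (card (triangles S (pop a) (pop b) (pop c))))^26 \<le> X"
      using triangles_bound by (simp add: X_def)
    then have "root 26 ((real (a * b * c) * real (card (triangles S (pop a) (pop b) (pop c))))^26) \<le> R"
      unfolding R_def by (intro real_root_le_mono) auto
    then show "real (a * b * c) * real (card (triangles S (pop a) (pop b) (pop c))) \<le> R"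
      by (simp add: real_root_power_cancel)
  qed
  moreover have t0: "t \<ge> 0" unfolding t_def by (intro sum_nonneg) auto
  ultimately have "t^26 \<le> (8 * real L^3 * R)^26" by (intro power_mono)
  also have "\<dots> = (8 * real L^3)^26 * X" using X0 by (simp add: R_def power_mult_distrib)
  finally have 1: "t^26 \<le> (8 * real L^3)^26 * X" .
  have "energy S \<ge> 0" unfolding energy_def by (intro sum_nonneg) auto
  then have "(energy S^3)^26 \<le> (N^3 * t)^26"
    using energy_cube_le_triangle_sum[OF fin] by (intro power_mono) (simp_all add: t_def)
  then have "energy S^78 \<le> N^78 * t^26" by (simp add: power_mult_distrib flip: power_mult)
  also have "\<dots> \<le> N^78 * ((8 * real L^3)^26 * X)" using 1 by (intro mult_left_mono) auto
  also have "\<dots> = 2^138 * real L^102 * G^40 * N^154"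
    unfolding X_def by algebra
  finally show ?thesis .
qed

end

section \<open>Sets with small product set\<close>

text \<open>Petridis' lemma: \<open>X\<close> minimises the ratio \<open>card (A * X) / card X\<close>.\<close>

lemma card_triple_product_le:
  fixes A X T :: "real set" and \<kappa> :: real
  assumes fin: "finite A" "finite X" "finite T" and T0: "0 \<notin> T"
    and min: "\<And>Y. Y \<subseteq> X \<Longrightarrow> \<kappa> * card Y \<le> card (A * Y)"
    and X: "card (A * X) = \<kappa> * card X"
  shows "card (T * (A * X)) \<le> \<kappa> * card (T * X)"
  using fin(3) T0
proof (induction T rule: finite_induct)
  case empty
  then show ?case by (simp add: set_times_def)
next
  case (insert t T)
  then have t: "t \<noteq> 0" and IH: "card (T * (A * X)) \<le> \<kappa> * card (T * X)" by auto
  have split: "insert t T * Z = T * Z \<union> (*) t ` Z" for Z :: "real set"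
    by (auto simp: set_times_def)
  have inj: "inj_on ((*) t) Z" for Z using t by (auto simp: inj_on_def)
  have finTX: "finite (T * X)" "finite (A * X)" "finite (T * (A * X))"
    using fin insert by (auto intro!: finite_set_times)
  \<comment> \<open>\<open>Y\<close> collects the \<open>x\<close> for which all products
    \<open>t * (a * x)\<close> are old. Adding \<open>t\<close> then creates at most
    \<open>card (A * X) - card (A * Y)\<close> new elements of \<open>T * (A * X)\<close>, but
    \<open>card X - card Y\<close> new elements of \<open>T * X\<close>; \<open>min\<close> for
    \<open>Y\<close> compares the two.\<close>
  define Y where "Y = {x\<in>X. \<forall>a\<in>A. t * (a * x) \<in> T * (A * X)}"
  have Y: "Y \<subseteq> X" by (auto simp: Y_def)
  have finY: "finite Y" using Y fin finite_subset by blast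
  have finAY: "finite (A * Y)" using fin finY by (simp add: finite_set_times)
  have AY: "A * Y \<subseteq> A * X" using Y by (auto simp: set_times_def)
  have "(*) t ` (A * Y) \<subseteq> T * (A * X)"
    by (auto simp: set_times_def Y_def)
  then have "T * (A * X) \<union> (*) t ` (A * X) = T * (A * X) \<union> (*) t ` (A * X - A * Y)" by auto
  then have "card (insert t T * (A * X)) \<le> card (T * (A * X)) + card ((*) t ` (A * X - A * Y))"
    unfolding split by (metis card_Un_le)
  also have "card ((*) t ` (A * X - A * Y)) = card (A * X - A * Y)" by (rule card_image[OF inj])
  also have "\<dots> = card (A * X) - card (A * Y)" by (rule card_Diff_subset[OF finAY AY])
  finally have "card (insert t T * (A * X)) + card (A * Y) \<le> card (T * (A * X)) + card (A * X)"
    using card_mono[OF finTX(2) AY] by linarith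
  then have 1: "real (card (insert t T * (A * X))) \<le> \<kappa> * card (T * X) + \<kappa> * card X - \<kappa> * card Y"
    using IH X min[OF Y] by linarith
  have "(*) t ` (X - Y) \<inter> (T * X) = {}"
  proof (rule ccontr)
    assume "(*) t ` (X - Y) \<inter> (T * X) \<noteq> {}"
    then obtain x where "x \<in> X - Y" "t * x \<in> T * X" by blast
    then obtain s x' where x: "x \<in> X - Y" "s \<in> T" "x' \<in> X" "t * x = s * x'"
      by (metis set_times_elim)
    have "t * (a * x) \<in> T * (A * X)" if "a \<in> A" for a
    proof -
      have "t * (a * x) = s * (a * x')" using x(4) by (simp add: mult.left_commute)
      moreover have "s * (a * x') \<in> T * (A * X)" using x that by (intro set_times_intro)
      ultimately show ?thesis by (simp only:)
    qed
    then show False using x(1) by (auto simp: Y_def)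
  qed
  then have "card (T * X) + card (X - Y) = card (T * X \<union> (*) t ` (X - Y))"
    using finTX fin by (subst card_Un_disjoint) (auto simp: card_image[OF inj])
  also have "\<dots> \<le> card (insert t T * X)"
    unfolding split using finTX fin by (intro card_mono) auto
  finally have "card (T * X) + card X \<le> card (insert t T * X) + card Y"
    using card_Diff_subset[OF finY Y] card_mono[OF fin(2) Y] by linarith
  then have 2: "real (card (T * X)) + card X \<le> card (insert t T * X) + card Y" by linarith
  show ?case
  proof (cases "X = {}")
    case True
    then show ?thesis by (simp add: set_times_def)
  next
    case False
    then have "card X > 0" using fin by (simp add: card_gt_0_iff)
    then have "\<kappa> \<ge> 0" using X by (metis of_nat_0_le_iff of_nat_0_less_iff zero_le_mult_iff not_less)
    then have "\<kappa> * (real (card (T * X)) + card X) \<le> \<kappa> * (card (insert t T * X) + card Y)"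
      using 2 by (intro mult_left_mono)
    with 1 show ?thesis by (simp add: algebra_simps)
  qed
qed

text \<open>\<open>X\<close> minimises the growth ratio among nonempty subsets of \<open>A\<close>.
  It cannot be small, because \<open>A * X\<close> contains a dilate of \<open>A\<close>; this
  matters since \<open>X\<close> later provides the slopes of the lines.\<close>

lemma ex_small_triple_product:
  fixes A :: "real set" and M :: real
  assumes fin: "finite A" and A: "A \<noteq> {}" "0 \<notin> A"
    and small: "card (A * A) \<le> M * card A"
  obtains X where "X \<subseteq> A" "card A \<le> M * card X" "card (X * (A * A)) \<le> M^2 * card A"
proof -
  define f where "f = (\<lambda>X. real (card (A * X)) / card X)"
  define F where "F = {X. X \<subseteq> A \<and> X \<noteq> {}}"
  have finF: "finite F" and neF: "A \<in> F" using fin A by (auto simp: F_def)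
  define X where "X = arg_min_on f F"
  have X: "X \<in> F" and minX: "\<And>Y. Y \<in> F \<Longrightarrow> f X \<le> f Y"
    using arg_min_if_finite[OF finF, of f] arg_min_least[OF finF] neF by (auto simp: X_def)
  have XA: "X \<subseteq> A" "X \<noteq> {}" "finite X" using X fin finite_subset by (auto simp: F_def)
  have cX: "card X > 0" using XA by (simp add: card_gt_0_iff)
  have cA: "card A > 0" using fin A by (simp add: card_gt_0_iff)
  define \<kappa> where "\<kappa> = f X"
  have \<kappa>0: "\<kappa> \<ge> 0" by (simp add: \<kappa>_def f_def)
  have "\<kappa> \<le> f A" unfolding \<kappa>_def by (rule minX[OF neF])
  also have "\<dots> \<le> M" using small cA by (simp add: f_def divide_le_eq)
  finally have \<kappa>M: "\<kappa> \<le> M" .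
  have eq: "card (A * X) = \<kappa> * card X" using cX by (simp add: \<kappa>_def f_def)
  have "\<kappa> * card Y \<le> card (A * Y)" if "Y \<subseteq> X" for Y
  proof (cases "Y = {}")
    case False
    with that XA have "Y \<in> F" by (auto simp: F_def)
    then have "f X \<le> f Y" by (rule minX)
    then have "\<kappa> * card Y \<le> f Y * card Y" unfolding \<kappa>_def by (intro mult_right_mono) auto
    also have "\<dots> = card (A * Y)"
      using False finite_subset[OF that XA(3)] by (simp add: f_def)
    finally show ?thesis .
  qed simp
  then have "card (A * (A * X)) \<le> \<kappa> * card (A * X)"
    using fin XA A eq by (intro card_triple_product_le) auto
  also have "\<dots> = \<kappa>^2 * card X" by (simp add: eq power2_eq_square)
  also have "\<dots> \<le> M^2 * card A"
    using \<kappa>0 \<kappa>M fin XA by (intro mult_mono power_mono) (auto intro: card_mono)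
  finally have 1: "card (X * (A * A)) \<le> M^2 * card A"
    by (simp add: mult.commute mult.left_commute)
  obtain x where x: "x \<in> X" using XA by auto
  have "card A \<le> card (A * X)"
    using fin XA A x by (intro card_inj_on_le[where f = "\<lambda>a. a * x"])
      (auto simp: inj_on_def set_times_def intro!: finite_set_times)
  also have "real \<dots> \<le> M * card X" unfolding eq using \<kappa>M by (intro mult_right_mono) auto
  finally have "card A \<le> M * card X" by simp
  with that XA 1 show ?thesis by blast
qed

section \<open>Dilates of a sumset\<close>

text \<open>The rich line bound controls \<open>t^3\<close>, and \<open>t \<le> card B\<close> pays
  for one more power. Fourth powers are what Cauchy-Schwarz leaves when the squared counts for
  \<open>B\<close> and for \<open>C\<close> are separated.\<close>

lemma sum_rich_fourth_powers_le:
  fixes B :: "real set"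
  assumes B: "finite B" "card B < 2^L" and \<Lambda>: "finite \<Lambda>"
    and rich: "\<And>l c. (l, c) \<in> \<Lambda> \<Longrightarrow> l \<noteq> 0 \<and> 2 \<le> card {x\<in>B. l * x + c \<in> B}"
  shows "(\<Sum>(l, c)\<in>\<Lambda>. real (card {x\<in>B. l * x + c \<in> B})^4) \<le> 3200 * real L * real (card B)^5"
proof -
  define i where "i = (\<lambda>(l, c). card {x\<in>B. l * x + c \<in> B})"
  define m where "m = card B"
  have i_le: "i z \<le> m" for z
    using B by (auto simp: i_def m_def split: prod.splits intro: card_mono)
  have lines: "card {z\<in>\<Lambda>. t \<le> i z} * t^3 \<le> 200 * m^4" if "t \<ge> 2" for t
  proof -
    have "card {z\<in>\<Lambda>. t \<le> i z} * t^3 \<le> 200 * (card B)^2 * (card B)^2"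
      by (rule rich_lines) (use B \<Lambda> rich that in \<open>auto simp: i_def\<close>)
    then show ?thesis by (simp add: m_def power_numeral_reduce mult_ac)
  qed
  have "(\<Sum>z\<in>\<Lambda>. real (i z)^4) \<le> 2^4 * real L * (200 * real m^5)"
  proof (rule sum_power_le_of_levels)
    fix t :: nat assume t: "t \<ge> 1"
    have "t^4 * card {z\<in>\<Lambda>. t \<le> i z} \<le> 200 * m^5"
    proof (cases "{z\<in>\<Lambda>. t \<le> i z} = {}")
      case False
      then have "t \<le> m" using i_le le_trans by blast
      moreover have "card {z\<in>\<Lambda>. t \<le> i z} * t^3 \<le> 200 * m^4"
      proof (cases "t \<ge> 2")
        \<comment> \<open>Every line in \<open>\<Lambda>\<close> has two points, so the level
          \<open>t = 1\<close> coincides with the level 2.\<close>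
        case False
        have "2 \<le> i z" if "z \<in> \<Lambda>" for z
          using rich that by (cases z) (simp add: i_def)
        with False have "{z\<in>\<Lambda>. t \<le> i z} = {z\<in>\<Lambda>. 2 \<le> i z}" by fastforce
        moreover have "t = 1" using False t by simp
        ultimately show ?thesis using lines[of 2] by simp
      qed (rule lines)
      ultimately have "t * (card {z\<in>\<Lambda>. t \<le> i z} * t^3) \<le> m * (200 * m^4)"
        by (rule mult_mono) auto
      then show ?thesis by (simp add: power_numeral_reduce mult_ac)
    qed (simp only: card.empty mult_0_right zero_le)
    then show "real t^4 * real (card {z\<in>\<Lambda>. t \<le> i z}) \<le> 200 * real m^5"
      using of_nat_mono[of "t^4 * card {z\<in>\<Lambda>. t \<le> i z}" "200 * m^5"] by simp
  next
    show "i z < 2^L" for z using i_le[of z] B by (simp add: m_def)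
  qed (use \<Lambda> in auto)
  then show ?thesis by (simp add: i_def m_def case_prod_unfold mult.assoc)
qed

lemma card_off_diagonal:
  assumes "finite B" "card B \<ge> 2"
  shows "real (card B)^2 \<le> 2 * real (card {p\<in>B\<times>B. fst p \<noteq> snd p})"
proof -
  have "{p\<in>B\<times>B. fst p \<noteq> snd p} = (SIGMA b:B. B - {b})" by auto
  then have "card {p\<in>B\<times>B. fst p \<noteq> snd p} = card B * (card B - 1)"
    using assms(1) by simp
  moreover have "card B * card B \<le> card B * (2 * (card B - 1))"
    using assms by (intro mult_left_mono) auto
  ultimately have "(card B)^2 \<le> 2 * card {p\<in>B\<times>B. fst p \<noteq> snd p}"
    by (simp add: power2_eq_square)
  then show ?thesis using of_nat_mono[of "(card B)^2"] by fastforce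
qed

text \<open>The quadruples \<open>(w(b\<^sub>1+c\<^sub>1), w(b\<^sub>1+c\<^sub>2), w(b\<^sub>2+c\<^sub>1), w(b\<^sub>2+c\<^sub>2))\<close> are additive. Two of them
  coincide only if an affine map \<open>x \<mapsto> l x + \<mu>\<close> carries one pair from \<open>B\<close> to the other and
  \<open>x \<mapsto> l x - \<mu>\<close> carries one pair from \<open>C\<close> to the other, and rich lines are rare.\<close>

lemma energy_dilated_sumset_ge:
  fixes B C W :: "real set"
  assumes fin: "finite B" "finite C" "finite W" and W: "W \<noteq> {}" "0 \<notin> W"
    and two: "card B \<ge> 2" "card C \<ge> 2" and L: "card B < 2^L" "card C < 2^L"
  shows "real (card W)^2 * (real (card B) * real (card C))^3
    \<le> 2^32 * real L^2 * energy (W * (B + C))^2"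
proof -
  define S where "S = W * (B + C)"
  define m where "m = real (card B)"
  define n where "n = real (card C)"
  define k where "k = real (card W)"
  define PB where "PB = {p\<in>B\<times>B. fst p \<noteq> snd p}"
  define PC where "PC = {p\<in>C\<times>C. fst p \<noteq> snd p}"
  define X where "X = W \<times> (PB \<times> PC)"
  define f where "f = (\<lambda>(w, (b1, b2), (c1, c2)).
    (w * (b1 + c1), w * (b1 + c2), w * (b2 + c1), w * (b2 + c2) :: real))"
  define VB where "VB = (\<lambda>(l, \<mu>). {b\<in>B. l * b + \<mu> \<in> B})"
  define VC where "VC = (\<lambda>(l, \<mu>). {c\<in>C. l * c + - \<mu> \<in> C})"
  define lam :: "(real \<times> (real \<times> real) \<times> (real \<times> real)) \<times> (real \<times> (real \<times> real) \<times> (real \<times> real))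
      \<Rightarrow> real \<times> real" where "lam = (\<lambda>((w, (b1, b2), (c1, c2)), (w', (b1', b2'), (c1', c2'))).
    (w / w', b1' - w / w' * b1 :: real))"
  define Col where "Col = {p\<in>X\<times>X. f (fst p) = f (snd p)}"
  define \<Lambda> where "\<Lambda> = lam ` Col"
  have finS: "finite S" using fin by (simp add: S_def finite_set_times finite_set_plus)
  have finX: "finite X" using fin by (simp add: X_def PB_def PC_def)
  have fin\<Lambda>: "finite \<Lambda>" using finX by (simp add: \<Lambda>_def Col_def)
  have finV: "finite (VB z)" "finite (VC z)" for z
    using fin by (auto simp: VB_def VC_def split: prod.splits)
  have m0: "m > 0" and n0: "n > 0" and k0: "k > 0"
    using two fin W by (auto simp: m_def n_def k_def card_gt_0_iff)

  \<comment> \<open>An additive quadruple is determined by three of its entries, so dropping the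
    third one is injective.\<close>
  have image: "real (card (f ` X)) \<le> energy S"
  proof -
    have "card (f ` X) \<le> card (SIGMA p:S\<times>S. {v\<in>S. v + (fst p - snd p) \<in> S})"
    proof (rule card_inj_on_le)
      let ?h = "\<lambda>(x, y, z, w). ((x, y), w :: real)"
      show "inj_on ?h (f ` X)"
        by (auto simp: inj_on_def f_def algebra_simps)
      show "?h ` f ` X \<subseteq> (SIGMA p:S\<times>S. {v\<in>S. v + (fst p - snd p) \<in> S})"
      proof (rule image_subsetI, elim imageE)
        fix q u assume u: "u \<in> X" "q = f u"
        obtain w b1 b2 c1 c2 where uu: "u = (w, (b1, b2), (c1, c2))" by (metis prod.collapse)
        have S: "w * (b + c) \<in> S" if "b \<in> {b1, b2}" "c \<in> {c1, c2}" for b c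
          using u that by (auto simp: S_def uu X_def PB_def PC_def)
        have "w * (b2 + c2) + (w * (b1 + c1) - w * (b1 + c2)) = w * (b2 + c1)"
          by (simp add: algebra_simps)
        with S[of b2 c1] have "w * (b2 + c2) + (w * (b1 + c1) - w * (b1 + c2)) \<in> S" by simp
        with S show "?h q \<in> (SIGMA p:S\<times>S. {v\<in>S. v + (fst p - snd p) \<in> S})"
          by (simp add: u uu f_def)
      qed
    qed (use finS in auto)
    also have "real \<dots> = energy S"
      using finS by (simp add: energy_def shift_count_def sum.cartesian_product case_prod_unfold)
    finally show ?thesis by simp
  qed

  have Col: "w \<in> W \<and> w' \<in> W \<and> w / w' \<noteq> 0 \<and> b1 \<noteq> b2 \<and> c1 \<noteq> c2
      \<and> b1 \<in> VB (l, \<mu>) \<and> b2 \<in> VB (l, \<mu>) \<and> c1 \<in> VC (l, \<mu>) \<and> c2 \<in> VC (l, \<mu>)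
      \<and> w' = w / l \<and> b1' = l * b1 + \<mu> \<and> b2' = l * b2 + \<mu> \<and> c1' = l * c1 - \<mu> \<and> c2' = l * c2 - \<mu>"
    if "((w, (b1, b2), (c1, c2)), (w', (b1', b2'), (c1', c2'))) \<in> Col"
      "l = w / w'" "\<mu> = b1' - w / w' * b1"
    for w b1 b2 c1 c2 w' b1' b2' c1' c2' l \<mu>
  proof -
    have mem: "w \<in> W" "w' \<in> W" "b1 \<in> B" "b2 \<in> B" "c1 \<in> C" "c2 \<in> C" "b1 \<noteq> b2" "c1 \<noteq> c2"
        "b1' \<in> B" "b2' \<in> B" "c1' \<in> C" "c2' \<in> C"
      and eqs: "w * (b1 + c1) = w' * (b1' + c1')" "w * (b1 + c2) = w' * (b1' + c2')"
        "w * (b2 + c1) = w' * (b2' + c1')"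
      using that(1) by (auto simp: Col_def X_def f_def PB_def PC_def)
    have w: "w \<noteq> 0" "w' \<noteq> 0" using mem W by auto
    have "l * (b1 + c1) = b1' + c1'" "l * (b1 + c2) = b1' + c2'" "l * (b2 + c1) = b2' + c1'"
      using eqs w by (simp_all add: that(2) field_simps)
    moreover have \<mu>: "\<mu> = b1' - l * b1" by (simp add: that(2,3))
    ultimately have "b1' = l * b1 + \<mu>" "b2' = l * b2 + \<mu>" "c1' = l * c1 - \<mu>" "c2' = l * c2 - \<mu>"
      unfolding \<mu> by (simp_all add: algebra_simps)
    with mem w show ?thesis by (simp add: VB_def VC_def that(2))
  qed

  \<comment> \<open>Once \<open>(l, \<mu>)\<close> is known, the first configuration determines the
    second; hence only one factor \<open>card W\<close> appears.\<close>
  have collisions: "card Col \<le> card W * (\<Sum>z\<in>\<Lambda>. (card (VB z))^2 * (card (VC z))^2)"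
  proof -
    have "card Col \<le> card (SIGMA z:\<Lambda>. W \<times> ((VB z \<times> VB z) \<times> (VC z \<times> VC z)))"
    proof (rule card_inj_on_le)
      let ?h = "\<lambda>p. (lam p, fst p)"
      let ?g = "\<lambda>((l, \<mu>), (w, (b1, b2), (c1, c2))).
        ((w, (b1, b2), (c1, c2)), (w / l, (l * b1 + \<mu>, l * b2 + \<mu>), (l * c1 - \<mu>, l * c2 - \<mu>)))"
      show "inj_on ?h Col"
      proof (rule inj_on_inverseI[of _ ?g])
        fix p assume p: "p \<in> Col"
        obtain w b1 b2 c1 c2 w' b1' b2' c1' c2'
          where pp: "p = ((w, (b1, b2), (c1, c2)), (w', (b1', b2'), (c1', c2')))"
          by (metis prod.collapse)
        show "?g (?h p) = p"
          using Col[OF p[unfolded pp] refl refl] by (simp add: pp lam_def)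
      qed
      show "?h ` Col \<subseteq> (SIGMA z:\<Lambda>. W \<times> ((VB z \<times> VB z) \<times> (VC z \<times> VC z)))"
      proof (rule image_subsetI)
        fix p assume p: "p \<in> Col"
        obtain w b1 b2 c1 c2 w' b1' b2' c1' c2'
          where pp: "p = ((w, (b1, b2), (c1, c2)), (w', (b1', b2'), (c1', c2')))"
          by (metis prod.collapse)
        have "lam p \<in> \<Lambda>" using p by (simp add: \<Lambda>_def)
        then show "?h p \<in> (SIGMA z:\<Lambda>. W \<times> ((VB z \<times> VB z) \<times> (VC z \<times> VC z)))"
          using Col[OF p[unfolded pp] refl refl] by (simp add: pp lam_def)
      qed
      show "finite (SIGMA z:\<Lambda>. W \<times> ((VB z \<times> VB z) \<times> (VC z \<times> VC z)))"
        using fin\<Lambda> fin finV by auto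
    qed
    also have "\<dots> = card W * (\<Sum>z\<in>\<Lambda>. (card (VB z))^2 * (card (VC z))^2)"
      using fin\<Lambda> fin finV
      by (simp add: card_cartesian_product sum_distrib_left power2_eq_square mult_ac)
    finally show ?thesis .
  qed

  \<comment> \<open>Restricting to pairs of distinct elements pays off here: each map that occurs is
    rich for both \<open>B\<close> and \<open>C\<close>.\<close>
  have \<Lambda>: "fst z \<noteq> 0 \<and> 2 \<le> card (VB z) \<and> 2 \<le> card (VC z)" if z\<Lambda>: "z \<in> \<Lambda>" for z
  proof -
    obtain p where p: "p \<in> Col" "z = lam p" using z\<Lambda> unfolding \<Lambda>_def by blast
    obtain w b1 b2 c1 c2 w' b1' b2' c1' c2'
      where pp: "p = ((w, (b1, b2), (c1, c2)), (w', (b1', b2'), (c1', c2')))"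
      by (metis prod.collapse)
    have z: "z = (w / w', b1' - w / w' * b1)" by (simp add: p pp lam_def)
    have *: "fst z \<noteq> 0" "b1 \<noteq> b2" "c1 \<noteq> c2" "{b1, b2} \<subseteq> VB z" "{c1, c2} \<subseteq> VC z"
      using Col[OF p(1)[unfolded pp] refl refl] by (simp_all add: z)
    then show ?thesis
      using card_mono[OF finV(1) *(4)] card_mono[OF finV(2) *(5)] by simp
  qed
  have sumB: "(\<Sum>z\<in>\<Lambda>. real (card (VB z))^4) \<le> 3200 * real L * m^5"
    using sum_rich_fourth_powers_le[OF fin(1) L(1) fin\<Lambda>] \<Lambda>
    by (force simp: VB_def m_def case_prod_unfold)
  have sumC: "(\<Sum>z\<in>\<Lambda>. real (card (VC z))^4) \<le> 3200 * real L * n^5"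
  proof -
    define \<Lambda>' where "\<Lambda>' = (\<lambda>(l, \<mu>). (l, - \<mu>)) ` \<Lambda>"
    have "(\<Sum>(l, c)\<in>\<Lambda>'. real (card {x\<in>C. l * x + c \<in> C})^4) \<le> 3200 * real L * real (card C)^5"
      by (rule sum_rich_fourth_powers_le[OF fin(2) L(2)])
        (use fin\<Lambda> \<Lambda> in \<open>force simp: \<Lambda>'_def VC_def\<close>)+
    then show ?thesis
      unfolding \<Lambda>'_def by (subst (asm) sum.reindex)
        (auto simp: inj_on_def n_def VC_def case_prod_unfold)
  qed
  define Q where "Q = (\<Sum>z\<in>\<Lambda>. real (card (VB z))^2 * real (card (VC z))^2)"
  have Q2: "Q^2 \<le> (3200 * real L * m^5) * (3200 * real L * n^5)"
  proof -
    have "Q^2 \<le> (\<Sum>z\<in>\<Lambda>. (real (card (VB z))^2)^2) * (\<Sum>z\<in>\<Lambda>. (real (card (VC z))^2)^2)"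
      unfolding Q_def by (rule Cauchy_Schwarz_ineq_sum)
    also have "\<dots> \<le> (3200 * real L * m^5) * (3200 * real L * n^5)"
      using sumB sumC m0 by (intro mult_mono) (auto intro: sum_nonneg)
    finally show ?thesis .
  qed
  have Q0: "Q \<ge> 0" unfolding Q_def by (intro sum_nonneg) auto
  have E0: "energy S \<ge> 0" by (auto simp: energy_def intro!: sum_nonneg)
  have Xge: "k * (m^2 * n^2 / 4) \<le> real (card X)"
  proof -
    have "m^2 * n^2 \<le> (2 * real (card PB)) * (2 * real (card PC))"
      unfolding m_def n_def PB_def PC_def using fin two
      by (intro mult_mono card_off_diagonal) auto
    then have "k * (m^2 * n^2 / 4) \<le> k * (real (card PB) * real (card PC))"
      using k0 by (intro mult_left_mono) auto
    then show ?thesis by (simp add: X_def card_cartesian_product k_def)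
  qed
  have "(k * (m^2 * n^2 / 4))^2 \<le> real (card X)^2"
    using Xge k0 by (intro power_mono) auto
  also have "\<dots> \<le> real (card (f ` X)) * real (card Col)"
    unfolding Col_def by (rule card_sq_le_collisions[OF finX])
  also have "\<dots> \<le> energy S * (k * Q)"
    using image of_nat_mono[OF collisions, where 'a = real] E0
    by (intro mult_mono) (simp_all add: k_def Q_def)
  finally have "k * (k * (m * n)^4) \<le> k * (16 * energy S * Q)"
    by (simp add: power_mult_distrib power2_eq_square[of k] power_divide mult_ac flip: power_mult)
  then have "k * (m * n)^4 \<le> 16 * energy S * Q" using k0 by simp
  then have "(k * (m * n)^4)^2 \<le> (16 * energy S * Q)^2"
    using k0 m0 n0 by (intro power_mono) auto
  also have "\<dots> = 256 * energy S^2 * Q^2" by (simp add: power_mult_distrib)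
  also have "\<dots> \<le> 256 * energy S^2 * ((3200 * real L * m^5) * (3200 * real L * n^5))"
    using Q2 by (intro mult_left_mono) auto
  also have "\<dots> = (m * n)^5 * (2621440000 * real L^2 * energy S^2)"
    by (simp add: power_mult_distrib power2_eq_square)
  finally have "(m * n)^5 * (k^2 * (m * n)^3) \<le> (m * n)^5 * (2621440000 * real L^2 * energy S^2)"
    by (simp add: power_mult_distrib mult_ac flip: power_mult power_add)
  then have "k^2 * (m * n)^3 \<le> 2621440000 * (real L^2 * energy S^2)"
    using m0 n0 by simp
  also have "\<dots> \<le> 2^32 * (real L^2 * energy S^2)" by (intro mult_right_mono) auto
  finally show ?thesis by (simp add: k_def m_def n_def S_def mult.assoc)
qed

section \<open>Comparison of the two energy bounds\<close>

text \<open>With \<open>x = n powr (1/1000)\<close>, the constant is eventually below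
  \<open>x^100\<close> and the logarithmic term below \<open>x\<close>, so the total is below
  \<open>x^634\<close>, and \<open>634 < 1000\<close>.\<close>

lemma eventually_polylog_times_powr_less:
  "eventually (\<lambda>n::nat. c * (1 + 2 * log 2 n)^180 * (real n powr (1/1000))^354 < n) at_top"
proof -
  have 1: "eventually (\<lambda>n::nat. 1 + 2 * log 2 n < real n powr (1/1000)) at_top" by real_asymp
  have 2: "eventually (\<lambda>n::nat. \<bar>c\<bar> < real n powr (1/10)) at_top" by real_asymp
  show ?thesis
    using 1 2 eventually_gt_at_top[of 1]
  proof eventually_elim
    case (elim n)
    define x where "x = real n powr (1/1000)"
    have "c * (1 + 2 * log 2 n)^180 * x^354 \<le> \<bar>c\<bar> * x^180 * x^354"
      using elim by (intro mult_mono power_mono) (auto simp: x_def)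
    also have "\<dots> \<le> x^100 * x^180 * x^354"
      using elim by (intro mult_right_mono) (auto simp: x_def powr_power)
    also have "\<dots> = x^634" by (simp flip: power_add)
    also have "\<dots> = real n powr (634/1000)"
      using elim by (simp add: x_def powr_power)
    also have "\<dots> < real n powr 1" using elim by (intro powr_less_mono) auto
    finally show ?case using elim by (simp add: x_def)
  qed
qed

text \<open>Zero is removed only from the dilating factor: the second factor must remain the full
  \<open>A\<close>, since it is \<open>A\<close> that decomposes. The slopes come from the subset
  \<open>X\<close> of \<open>W\<close>, for which the triple product with \<open>W * W\<close> is
  controlled.\<close>

lemma energy_dilated_set_le:
  fixes A :: "real set" and P :: real
  defines "W \<equiv> A - {0}" and "K \<equiv> real (card A)"
  assumes fin: "finite A" and card: "card A \<ge> 2" and P: "P \<ge> 1"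
    and small: "card (A * A) \<le> K * P" and L: "card (W * A) < 2^L"
  shows "energy (W * A)^78 \<le> 2^138 * real L^102 * (2^15 * P^5 * K)^40 * (K * P)^154"
proof -
  define S where "S = W * A"
  have finW: "finite W" using fin by (simp add: W_def)
  have finS: "finite S" using fin finW by (simp add: S_def finite_set_times)
  have finAA: "finite (A * A)" using fin by (simp add: finite_set_times)
  have K: "K \<ge> 2" using card by (simp add: K_def)
  have "card A \<le> card W + 1" unfolding W_def
    using fin by (cases "0 \<in> A") (auto simp: card_Diff_singleton)
  then have cW: "K \<le> 2 * card W" "card W \<ge> 1" using card by (auto simp: K_def)
  have cWA: "card W \<le> card A" using fin by (intro card_mono) (auto simp: W_def)
  have Wne: "W \<noteq> {}" using cW by auto
  have "card (W * W) \<le> card (A * A)"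
    using finAA by (intro card_mono set_times_mono2) (auto simp: W_def)
  also have "real \<dots> \<le> K * P" by (rule small)
  also have "\<dots> \<le> (2 * P) * card W" using cW P by (simp add: mult.commute)
  finally have "card (W * W) \<le> (2 * P) * card W" by simp
  then obtain X where X: "X \<subseteq> W" "card W \<le> (2 * P) * card X"
      "card (X * (W * W)) \<le> (2 * P)^2 * card W"
    using ex_small_triple_product[OF finW Wne, of "2 * P"] by (auto simp: W_def)
  have finX: "finite X" using X finW finite_subset by blast
  have "card X > 0" using X(2) cW by (cases "card X = 0") auto
  define U where "U = real (card (X * S))"
  \<comment> \<open>\<open>A\<close> may contain 0 while \<open>W\<close> does not; the only product
    lost is 0.\<close>
  have "X * S \<subseteq> insert 0 (X * (W * W))"
  proof
    fix u assume "u \<in> X * S"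
    then obtain x w a where "x \<in> X" "w \<in> W" "a \<in> A" "u = x * (w * a)"
      by (auto simp: S_def elim!: set_times_elim)
    then show "u \<in> insert 0 (X * (W * W))"
      by (cases "a = 0") (auto simp: W_def intro!: set_times_intro)
  qed
  then have "card (X * S) \<le> card (insert 0 (X * (W * W)))"
    using finX finW by (intro card_mono) (auto intro!: finite_set_times)
  also have "\<dots> \<le> card (X * (W * W)) + 1" by (simp add: card_insert_le_m1 card_insert_if finX finW finite_set_times)
  finally have "U \<le> (2 * P)^2 * card W + 1" using X(3) by (simp add: U_def)
  also have "\<dots> \<le> (2 * P)^2 * K + P^2 * K"
  proof -
    have "1 * 1 \<le> P^2 * K" using P K by (intro mult_mono one_le_power) auto
    moreover have "(2 * P)^2 * card W \<le> (2 * P)^2 * K"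
      using cWA by (intro mult_left_mono) (auto simp: K_def)
    ultimately show ?thesis by linarith
  qed
  finally have U: "U \<le> 5 * (P^2 * K)" by (simp add: power_mult_distrib mult.commute)
  obtain w where w: "w \<in> W" using Wne by auto
  have "w * w \<in> S" "w * w \<noteq> 0" using w by (auto simp: S_def W_def intro: set_times_intro)
  then have XU: "card X \<le> card (X * S)"
    using finX finS
    by (intro card_inj_on_le[where f = "\<lambda>x. x * (w * w)"]) (auto simp: inj_on_def intro!: finite_set_times set_times_intro)
  define G where "G = 200 * U^2 / card X"
  interpret rare_differences S G L
  proof
    show "finite S" by (rule finS)
    show "card S < 2^L" using L by (simp add: S_def)
    fix D :: "real set" and t :: nat
    assume Dt: "finite D" "t \<ge> 1"
    have "0 \<notin> X" using X(1) by (auto simp: W_def)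
    from of_nat_mono[OF popular_shifts[OF finS finX Dt(1) this XU Dt(2)], where 'a = real]
    have "card X * (real t^3 * real (card {z. t \<le> shift_count S D z})) \<le> 200 * U^2 * real (card D)^2"
      by (simp add: U_def mult_ac)
    then show "real t^3 * real (card {z. t \<le> shift_count S D z}) \<le> G * real (card D)^2"
      using \<open>card X > 0\<close> by (simp add: G_def field_simps)
  qed
  \<comment> \<open>From \<open>U \<le> 5 * P^2 * K\<close> and
    \<open>card X \<ge> K / (4 * P)\<close> the quotient \<open>G\<close> is at most
    \<open>200 * 25 * 4 * P^5 * K\<close>.\<close>
  have KX: "K \<le> 4 * P * card X" using X(2) cW by linarith
  have "G * card X = 200 * U^2" using \<open>card X > 0\<close> by (simp add: G_def)
  also have "\<dots> \<le> 200 * (5 * (P^2 * K))^2"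
    using U by (intro mult_left_mono power_mono) (auto simp: U_def)
  also have "\<dots> = 5000 * P^4 * K * K" by algebra
  also have "\<dots> \<le> 5000 * P^4 * K * (4 * P * card X)"
    using KX P K by (intro mult_left_mono) auto
  also have "\<dots> = (20000 * P^5 * K) * card X" by algebra
  finally have "G \<le> 20000 * P^5 * K" using \<open>card X > 0\<close> by simp
  also have "\<dots> \<le> 2^15 * P^5 * K" using P K by (intro mult_right_mono) auto
  finally have G: "G \<le> 2^15 * P^5 * K" .
  have "card S \<le> card (A * A)"
    unfolding S_def using finAA by (intro card_mono set_times_mono2) (auto simp: W_def)
  then have N: "N \<le> K * P" using small by linarith
  have "energy S^78 \<le> 2^138 * real L^102 * G^40 * N^154" by (rule energy_bound)
  also have "\<dots> \<le> 2^138 * real L^102 * (2^15 * P^5 * K)^40 * (K * P)^154"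
    using G N G_nonneg P K by (intro mult_mono power_mono mult_nonneg_nonneg) auto
  finally show ?thesis by (simp only: S_def)
qed

theorem theorem2:
  "\<exists>\<epsilon>::real. \<epsilon> > 0 \<and>
     (\<exists>N::nat. \<forall>A::real set.
        finite A \<longrightarrow> card A \<ge> N \<longrightarrow>
        real (card (A * A)) \<le> real (card A) powr (1 + \<epsilon>) \<longrightarrow>
        \<not> (\<exists>B C :: real set. card B \<ge> 2 \<and> card C \<ge> 2 \<and> A = B + C))"
proof -
  obtain N0 where N0: "\<And>n::nat. n \<ge> N0 \<Longrightarrow>
      2^2064 * (1 + 2 * log 2 n)^180 * (real n powr (1/1000))^354 < n"
    using eventually_polylog_times_powr_less[of "2^2064"] by (auto simp: eventually_at_top_linorder)
  have False
    if A: "finite A" "card A \<ge> N0" "real (card (A * A)) \<le> real (card A) powr (1 + 1/1000)"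
      and BC: "card B \<ge> 2" "card C \<ge> 2" "A = B + C" for A B C :: "real set"
  proof -
    define K where "K = real (card A)"
    define P where "P = K powr (1/1000)"
    define W where "W = A - {0}"
    define m where "m = real (card B)"
    define n where "n = real (card C)"
    have finB: "finite B" and finC: "finite C"
      using BC card.infinite by force+
    have le_shift: "card B \<le> card A" "card C \<le> card A"
    proof -
      obtain b c where bc: "b \<in> B" "c \<in> C" using BC by (metis card.empty ex_in_conv not_numeral_le_zero)
      have fin: "finite (B + C)" using A(1) BC(3) by simp
      show "card B \<le> card A" unfolding BC(3)
        by (rule card_inj_on_le[where f = "\<lambda>x. x + c", OF _ _ fin]) (use bc in auto)
      show "card C \<le> card A" unfolding BC(3)
        by (rule card_inj_on_le[where f = "\<lambda>x. b + x", OF _ _ fin]) (use bc in auto)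
    qed
    have cA: "card A \<ge> 2" using le_shift BC by linarith
    have K: "K \<ge> 2" using cA by (simp add: K_def)
    have P: "P \<ge> 1" "P \<le> K" unfolding P_def using K powr_mono[of "1/1000" 1 K] by (auto simp: ge_one_powr_ge_zero)
    have small: "card (A * A) \<le> K * P"
      using A(3) powr_add[of "real (card A)" 1 "1/1000"] by (simp add: P_def K_def)
    have W: "finite W" "0 \<notin> W" using A by (auto simp: W_def)
    have "card A \<le> card W + 1" unfolding W_def
      using A(1) by (cases "0 \<in> A") (auto simp: card_Diff_singleton)
    then have cW: "K \<le> 2 * card W" and Wne: "W \<noteq> {}" using cA by (auto simp: K_def)
    obtain w where w: "w \<in> W" using Wne by auto
    have finWA: "finite (W * A)" using W A by (simp add: finite_set_times)
    have AWA: "card A \<le> card (W * A)"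
      using finWA w W(2) by (intro card_inj_on_le[where f = "\<lambda>x. w * x"]) (auto simp: inj_on_def intro: set_times_intro)
    have "card (W * A) \<le> card (A * A)"
      using A(1) by (intro card_mono set_times_mono2 finite_set_times) (auto simp: W_def)
    also have "real \<dots> \<le> K * P" by (rule small)
    also have "\<dots> \<le> K * K" using P K by (intro mult_left_mono) auto
    finally have cWA: "card (W * A) \<le> K^2" by (simp add: power2_eq_square)
    \<comment> \<open>One number of scales serves three sets: \<open>B\<close> and \<open>C\<close>
      have translates inside \<open>A\<close>, and \<open>W * A\<close> contains a dilate of
      \<open>A\<close>. The bound \<open>K^2\<close> on its size keeps that number
      logarithmic.\<close>
    obtain j where j: "2^j \<le> card (W * A)" "card (W * A) < 2^(j+1)"
      using ex_power_ivl1[of 2 "card (W * A)"] AWA cA by auto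
    define L where "L = j + 1"
    have "2 powr real j \<le> K^2"
      using j(1) cWA by (simp add: powr_realpow) (metis of_nat_le_iff of_nat_numeral of_nat_power order_trans)
    then have "real j \<le> log 2 (K^2)" using K by (simp add: le_log_iff)
    then have L: "real L \<le> 1 + 2 * log 2 K" using K by (simp add: L_def log_nat_power)
    have WA_less: "card (W * A) < 2^L" using j by (simp add: L_def)
    define E where "E = energy (W * A)"
    have upper: "E^78 \<le> 2^138 * real L^102 * (2^15 * P^5 * K)^40 * (K * P)^154"
      unfolding E_def K_def W_def
      by (rule energy_dilated_set_le)
        (use A(1) cA P small WA_less in \<open>auto simp: K_def W_def\<close>)
    have lower: "real (card W)^2 * (m * n)^3 \<le> 2^32 * real L^2 * E^2"
      unfolding m_def n_def E_def BC(3)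
      by (rule energy_dilated_sumset_ge)
        (use W Wne BC finB finC le_shift AWA WA_less in \<open>auto simp: BC(3)[symmetric]\<close>)
    have "card A \<le> card (B \<times> C)"
      unfolding BC(3) using finB finC
      by (intro surj_card_le[of _ _ "\<lambda>(b, c). b + c"]) (auto simp: set_plus_def)
    then have mn: "K \<le> m * n" by (simp add: K_def m_def n_def card_cartesian_product flip: of_nat_mult)
    have "K^5 = 4 * ((K/2)^2 * K^3)" by (simp add: power_divide flip: power_add)
    also have "\<dots> \<le> 4 * (real (card W)^2 * (m * n)^3)"
      using cW mn K by (intro mult_left_mono mult_mono power_mono) auto
    also have "\<dots> \<le> 4 * (2^32 * real L^2 * E^2)" using lower by (intro mult_left_mono) auto
    also have "\<dots> = 2^34 * real L^2 * E^2" by simp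
    \<comment> \<open>The power 39 turns \<open>E^2\<close> into the available \<open>E^78\<close>;
      on the left \<open>K^195\<close> exceeds \<open>K^40 * K^154\<close> by one factor
      \<open>K\<close>.\<close>
    finally have "(K^5)^39 \<le> (2^34 * real L^2 * E^2)^39" using K by (intro power_mono) auto
    then have "K * K^194 \<le> 2^1326 * real L^78 * E^78"
      by (simp add: power_mult_distrib flip: power_mult power_Suc)
    also have "\<dots> \<le> 2^1326 * real L^78 * (2^138 * real L^102 * (2^15 * P^5 * K)^40 * (K * P)^154)"
      using upper by (intro mult_left_mono) auto
    \<comment> \<open>The exponents add up as \<open>2064 = 1326 + 138 + 15 * 40\<close>,
      \<open>180 = 78 + 102\<close> and \<open>354 = 5 * 40 + 154\<close>.\<close>
    also have "\<dots> = (2^2064 * real L^180 * P^354) * K^194" by algebra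
    finally have "K \<le> 2^2064 * real L^180 * P^354" using K by simp
    also have "\<dots> \<le> 2^2064 * (1 + 2 * log 2 K)^180 * P^354"
      using L P by (intro mult_right_mono mult_left_mono power_mono) auto
    also have "\<dots> < K" using N0[OF A(2)] by (simp add: K_def P_def)
    finally show False by simp
  qed
  then show ?thesis
    by (intro exI[of _ "1/1000"] conjI exI[of _ N0]) auto
qed

end
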